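(* For all $p\in(0,\infty)$, $q\in(1,\infty)$, $M\in[1,\infty)$, $\delta>0$ and every positive integer $n$, there is a positive constant $C$ depending only on $p$, $q$, $n$, $\delta$ and $M$ such that the following holds. Let $\Omega\subset\mathbb{C}^{n}$ be a $\delta$-John domain, let $f=h+\overline{g}$ be a pluriharmonic function in $\Omega$, where $h$ and $g$ are holomorphic in $\Omega$, and let $\omega\in A_{M}^{q}(\mathbb{C}^{n})$. Then $$\inf_{a\in\mathbb{C}}\|h-a\|_{p,\Omega,\omega}+\inf_{b\in\mathbb{C}}\|g-b\|_{p,\Omega,\omega}\leq C\|f\|_{p,\Omega,\omega}.$$
   Context: $\mathbb{C}^n$ is identified with $\mathbb{R}^{2n}$; $d\mu$ is Lebesgue measure and $|Q|$ is the Lebesgue measure of $Q$. A twice continuously differentiable complex-valued function $f$ is pluriharmonic if $\partial^2 f/\partial z_j\partial\overline{z}_k=0$ for all $j,k$. John domain: a proper subdomain $\Omega\subset\mathbb{C}^n$ is a $\delta$-John domain, $\delta>0$, if there is a point $x_0\in\Omega$ which can be joined with any point $x\in\Omega$ by a continuous curve $\gamma\subset\Omega$ satisfying $\delta|\xi-x|\leq d_\Omega(\xi)$ for all $\xi\in\gamma$, where $d_\Omega(\xi)$ is the Euclidean distance from $\xi$ to the boundary of $\Omega$. Weights: for $\omega\in L^1_{loc}(\mathbb{R}^{m})$ with $\omega>0$ a.e., $p\in(0,\infty)$ and a measurable set $E\subset\mathbb{R}^m$, $$\|f\|_{p,E,\omega}=\left(\int_E|f(x)|^p\omega(x)\,d\mu(x)\right)^{1/p}\in[0,\infty].$$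 For $q\in(1,\infty)$ and $M\in[1,\infty)$, $\omega\in A^q_M(\mathbb{C}^n)$ (Muckenhoupt weight) means $\omega\in L^1_{loc}$, $\omega>0$ a.e., and for each cube or ball $Q\subset\mathbb{C}^n\cong\mathbb{R}^{2n}$, $$\int_Q\omega\,d\mu\leq M|Q|^{q}\left(\int_Q\omega^{1/(1-q)}\,d\mu\right)^{1-q}.$$ *)

theory Defs
  imports "HOL-Analysis.Analysis"
begin

text \<open>
  Complex \<open>n\<close>-space is the type \<open>complex ^ 'n\<close> with \<open>n = CARD('n)\<close>. As a \<open>euclidean_space\<close> it is
  \<open>\<real>\<^sup>2\<^sup>n\<close>: its basis is \<open>axis j 1, axis j \<i>\<close>, its norm is the Euclidean norm and \<open>lebesgue\<close> is
  \<open>2n\<close>-dimensional Lebesgue measure.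
\<close>

section \<open>Holomorphic and pluriharmonic functions of several variables\<close>

definition holomorphic_on_cn :: "(complex ^ 'n \<Rightarrow> complex) \<Rightarrow> (complex ^ 'n) set \<Rightarrow> bool"
  where "holomorphic_on_cn f \<Omega> \<longleftrightarrow>
    (\<forall>z\<in>\<Omega>. \<exists>D. (f has_derivative D) (at z) \<and> (\<forall>c v. D (c *s v) = c * D v))"

definition real_pderiv ::
    "complex ^ 'n \<Rightarrow> (complex ^ 'n \<Rightarrow> complex) \<Rightarrow> complex ^ 'n \<Rightarrow> complex"
  where "real_pderiv v f z = frechet_derivative f (at z) v"

text \<open>For open \<open>\<Omega>\<close> this is twice continuous differentiability in the real sense.\<close>

definition C2_on :: "(complex ^ 'n \<Rightarrow> complex) \<Rightarrow> (complex ^ 'n) set \<Rightarrow> bool"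
  where "C2_on f \<Omega> \<longleftrightarrow>
    f differentiable_on \<Omega> \<and>
    (\<forall>v. real_pderiv v f differentiable_on \<Omega>) \<and>
    (\<forall>u v. continuous_on \<Omega> (real_pderiv u (real_pderiv v f)))"

text \<open>With \<open>z\<^sub>j = x\<^sub>j + \<i> y\<^sub>j\<close>, the directions \<open>axis j 1\<close> and \<open>axis j \<i>\<close> are those of \<open>x\<^sub>j\<close> and \<open>y\<^sub>j\<close>.\<close>

definition wirtinger :: "'n \<Rightarrow> (complex ^ 'n \<Rightarrow> complex) \<Rightarrow> complex ^ 'n \<Rightarrow> complex"
  where "wirtinger j f z = (real_pderiv (axis j 1) f z - \<i> * real_pderiv (axis j \<i>) f z) / 2"

definition wirtinger_bar :: "'n \<Rightarrow> (complex ^ 'n \<Rightarrow> complex) \<Rightarrow> complex ^ 'n \<Rightarrow> complex"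
  where "wirtinger_bar j f z = (real_pderiv (axis j 1) f z + \<i> * real_pderiv (axis j \<i>) f z) / 2"

definition pluriharmonic_on :: "(complex ^ 'n \<Rightarrow> complex) \<Rightarrow> (complex ^ 'n) set \<Rightarrow> bool"
  where "pluriharmonic_on f \<Omega> \<longleftrightarrow>
    C2_on f \<Omega> \<and> (\<forall>z\<in>\<Omega>. \<forall>j k. wirtinger j (wirtinger_bar k f) z = 0)"


section \<open>John domains\<close>

definition john_domain :: "real \<Rightarrow> (complex ^ 'n) set \<Rightarrow> bool"
  where "john_domain \<delta> \<Omega> \<longleftrightarrow>
    open \<Omega> \<and> connected \<Omega> \<and> \<Omega> \<noteq> {} \<and> \<Omega> \<noteq> UNIV \<and>
    (\<exists>x\<^sub>0\<in>\<Omega>. \<forall>x\<in>\<Omega>. \<exists>\<gamma>. path \<gamma> \<and> pathstart \<gamma> = x\<^sub>0 \<and> pathfinish \<gamma> = x \<and> path_image \<gamma> \<subseteq> \<Omega> \<and>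
      (\<forall>\<xi>\<in>path_image \<gamma>. \<delta> * dist \<xi> x \<le> infdist \<xi> (frontier \<Omega>)))"


section \<open>Weights\<close>

text \<open>
  Real powers on \<open>[0,\<infinity>]\<close>, with \<open>\<infinity>\<^sup>s = 0\<close> and \<open>0\<^sup>s = \<infinity>\<close> for \<open>s < 0\<close>.
\<close>

definition ennreal_rpow :: "ennreal \<Rightarrow> real \<Rightarrow> ennreal"
  where "ennreal_rpow x s =
    (if s = 0 then 1
     else if x = \<infinity> then (if s > 0 then \<infinity> else 0)
     else if x = 0 then (if s > 0 then 0 else \<infinity>)
     else ennreal (enn2real x powr s))"

definition weight :: "(complex ^ 'n \<Rightarrow> real) \<Rightarrow> bool"
  where "weight \<omega> \<longleftrightarrow>
    (\<forall>K. compact K \<longrightarrow> \<omega> absolutely_integrable_on K) \<and> (AE x in lebesgue. \<omega> x > 0)"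

definition wnorm ::
    "real \<Rightarrow> (complex ^ 'n) set \<Rightarrow> (complex ^ 'n \<Rightarrow> real) \<Rightarrow> (complex ^ 'n \<Rightarrow> complex) \<Rightarrow> ennreal"
  where "wnorm p E \<omega> f =
    ennreal_rpow (\<integral>\<^sup>+x\<in>E. ennreal (norm (f x) powr p * \<omega> x) \<partial>lebesgue) (1 / p)"

text \<open>Nondegenerate cubes with sides parallel to the real coordinate axes, and balls.\<close>

definition cube_or_ball :: "(complex ^ 'n) set \<Rightarrow> bool"
  where "cube_or_ball Q \<longleftrightarrow>
    (\<exists>a r. r > 0 \<and> (Q = cbox a (a + r *\<^sub>R One) \<or> Q = ball a r))"

text \<open>
  By the convention above, the inequality forces \<open>\<omega>\<^sup>1\<^sup>/\<^sup>(\<^sup>1\<^sup>-\<^sup>q\<^sup>)\<close> to be integrable over \<open>Q\<close>, since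
  the left-hand side is positive.
\<close>

definition muckenhoupt :: "real \<Rightarrow> real \<Rightarrow> (complex ^ 'n \<Rightarrow> real) \<Rightarrow> bool"
  where "muckenhoupt q M \<omega> \<longleftrightarrow> weight \<omega> \<and>
    (\<forall>Q. cube_or_ball Q \<longrightarrow>
      (\<integral>\<^sup>+x\<in>Q. ennreal (\<omega> x) \<partial>lebesgue) \<le>
        ennreal M * ennreal_rpow (emeasure lebesgue Q) q *
        ennreal_rpow (\<integral>\<^sup>+x\<in>Q. ennreal (\<omega> x powr (1 / (1 - q))) \<partial>lebesgue) (1 - q))"

end

theory Submission
  imports Defs "HOL-Complex_Analysis.Conformal_Mappings"
begin

text \<open>
  Write \<open>W\<close> for the measure with density \<open>\<omega>\<close>, \<open>d(x)\<close> for the distance from \<open>x\<close> to the boundary of \<open>\<Omega>\<close>,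
  \<open>f = h + cnj g\<close>, and \<open>N = 2n\<close> for the real dimension. Since \<open>cnj f = g + cnj h\<close> has the same modulus
  as \<open>f\<close>, it is enough to bound the \<open>L\<^sup>p(W)\<close>-norm of \<open>h - h(x\<^sub>0)\<close>, where \<open>x\<^sub>0\<close> is the John centre. The
  argument has a local half, which uses that \<open>f\<close> is pluriharmonic, and a global half, which is a
  Poincare-type inequality for continuous functions on John domains.

  Local half. On complex lines \<open>f\<close> is a harmonic function of one variable. The Schwarz lemma, applied
  to \<open>h + g\<close> and \<open>\<i>(h - g)\<close>, whose real parts are controlled by \<open>\<bar>f\<bar>\<close>, shows that the oscillation of
  \<open>h\<close> on a ball is at most a multiple of the supremum of \<open>\<bar>f\<bar>\<close> on a twice larger ball
  (\<open>holomorphic_part_oscillation\<close>). That supremum is controlled by the mean of \<open>\<bar>f\<bar>\<^sup>s\<close> for every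
  exponent \<open>s > 0\<close>, however small (\<open>pluriharmonic_power_sub_mean_value\<close>). With \<open>s = p/q\<close>, the
  Muckenhoupt condition turns this unweighted mean into a weighted mean of \<open>\<bar>f\<bar>\<^sup>p\<close>
  (\<open>muckenhoupt_holder\<close>). So on every ball \<open>B(x, d(x)/8)\<close> the difference \<open>h - h(x)\<close> has a bound \<open>a\<close> with
  \<open>a\<^sup>p W(B(x, C d(x))) \<le> K \<integral> \<bar>f\<bar>\<^sup>p dW\<close>, the integral being over \<open>B(x, d(x)/2)\<close>
  (\<open>weighted_oscillation_bound\<close>).

  Global half. Cover \<open>\<Omega>\<close> by Whitney balls \<open>B(x\<^sub>j, d(x\<^sub>j)/8)\<close> such that the balls \<open>B(x\<^sub>j, d(x\<^sub>j)/40)\<close> are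
  disjoint. Let \<open>u\<close> be continuous with \<open>u(x\<^sub>0) = 0\<close>. Along the John curve from \<open>x\<^sub>0\<close> to \<open>x\<close> the function
  \<open>u\<close> takes all values between \<open>0\<close> and \<open>u(x)\<close>, so the values taken on the Whitney balls that meet the
  curve cover \<open>[0, u(x)]\<close>, and \<open>u(x)\<close> is at most the sum of the lengths of intervals containing these
  sets of values. By the John condition a Whitney ball meeting the curve has
  \<open>x\<close> in a fixed multiple of itself (\<open>value_le_sum_of_oscillations\<close>). Integrating in \<open>x\<close> and using
  that \<open>W\<close> is doubling gives \<open>\<integral> u dW \<le> C \<Sum>\<^sub>j osc\<^sub>j(u) W(B(x\<^sub>j, d(x\<^sub>j)/40))\<close>.

  This is an \<open>L\<^sup>1\<close> estimate, and it is used with \<open>u = G\<^sup>p\<close>, where \<open>G\<close> is \<open>\<bar>h - h(x\<^sub>0)\<bar>\<close> truncated at a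
  level \<open>T\<close>. The elementary inequality \<open>\<bar>s\<^sup>p - t\<^sup>p\<bar> \<le> \<epsilon> t\<^sup>p + C\<^sub>\<epsilon> \<bar>s - t\<bar>\<^sup>p\<close> bounds the oscillation of
  \<open>G\<^sup>p\<close> on a ball by a small multiple of \<open>G\<^sup>p\<close> at any point of the ball plus a multiple of \<open>a\<^sup>p\<close>. The first term is
  absorbed in the left-hand side, which is finite thanks to the truncation; so one argument serves
  all \<open>p > 0\<close> (\<open>john_poincare\<close>). The local half and the
  bounded overlap of the balls \<open>B(x\<^sub>j, d(x\<^sub>j)/2)\<close> bound the second term by \<open>\<integral> \<bar>f\<bar>\<^sup>p dW\<close>. Finally
  \<open>T \<rightarrow> \<infinity>\<close>.
\<close>

section \<open>Rotations and discs\<close>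

lemma nn_integral_lborel_translate:
  fixes F :: "'a::euclidean_space \<Rightarrow> ennreal"
  assumes [measurable]: "F \<in> borel_measurable borel"
  shows "(\<integral>\<^sup>+x. F (c + x) \<partial>lborel) = (\<integral>\<^sup>+x. F x \<partial>lborel)"
proof -
  have "(\<integral>\<^sup>+x. F x \<partial>lborel) = (\<integral>\<^sup>+x. F x \<partial>distr lborel borel ((+) c))"
    by (simp add: lborel_distr_plus)
  also have "\<dots> = (\<integral>\<^sup>+x. F (c + x) \<partial>lborel)"
    by (subst nn_integral_distr) auto
  finally show ?thesis by simp
qed

text \<open>
  Translation invariance of Lebesgue measure forces invariance under linear isometries. Compute \<open>\<integral>\<integral> U(x) F(x + T y) dx dy\<close> for the indicator
  \<open>U\<close> of the unit ball in two ways: translation invariance in \<open>y\<close> gives \<open>c \<integral> F(T y) dy\<close>, and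
  translation invariance in \<open>x\<close>, followed by \<open>\<bar>x - T y\<bar> = \<bar>T\<^sup>-\<^sup>1 x - y\<bar>\<close>, gives \<open>c \<integral> F(x) dx\<close>, where
  \<open>c\<close> is the volume of the ball.
\<close>

lemma nn_integral_lborel_isometry:
  fixes F :: "'a::euclidean_space \<Rightarrow> ennreal" and T S :: "'a \<Rightarrow> 'a"
  assumes F [measurable]: "F \<in> borel_measurable borel"
    and T: "linear T" and inv: "\<And>x. T (S x) = x" and norm_T: "\<And>x. norm (T x) = norm x"
  shows "(\<integral>\<^sup>+x. F (T x) \<partial>lborel) = (\<integral>\<^sup>+x. F x \<partial>lborel)"
proof -
  define U :: "'a \<Rightarrow> ennreal" where "U = indicator (ball 0 1)"
  define c where "c = (\<integral>\<^sup>+x. U x \<partial>(lborel :: 'a measure))"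
  have U [measurable]: "U \<in> borel_measurable borel" unfolding U_def by (intro borel_measurable_indicator) simp
  have T_meas [measurable]: "T \<in> borel_measurable borel"
    using T by (intro borel_measurable_continuous_onI linear_continuous_on linear_conv_bounded_linear[THEN iffD1])
  have c: "c = emeasure lborel (ball (0::'a) 1)"
    unfolding c_def U_def by simp
  have c_fin: "c \<noteq> \<infinity>" and c_pos: "c \<noteq> 0"
    unfolding c by (use unit_ball_vol_pos[of "DIM('a)"] in \<open>auto simp: emeasure_ball simp del: unit_ball_vol_pos\<close>)
  have U_shift: "U (x - T y) = U (- S x + y)" for x y
  proof -
    have "norm (x - T y) = norm (T (S x - y))"
      using T by (simp add: linear_diff inv)
    also have "\<dots> = norm (- S x + y)"
      by (simp add: norm_T norm_minus_commute)
    finally show ?thesis by (simp add: U_def indicator_def)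
  qed
  have shift: "(\<integral>\<^sup>+y. F (T y) \<partial>lborel) = (\<integral>\<^sup>+y. F (x + T y) \<partial>lborel)" for x
  proof -
    have "(\<integral>\<^sup>+y. F (T y) \<partial>lborel) = (\<integral>\<^sup>+y. F (T (S x + y)) \<partial>lborel)"
      by (rule nn_integral_lborel_translate[symmetric]) measurable
    then show ?thesis using T by (simp add: linear_add inv)
  qed
  have "c * (\<integral>\<^sup>+y. F (T y) \<partial>lborel) = (\<integral>\<^sup>+x. U x * (\<integral>\<^sup>+y. F (T y) \<partial>lborel) \<partial>lborel)"
    unfolding c_def by (subst nn_integral_multc) auto
  also have "\<dots> = (\<integral>\<^sup>+x. (\<integral>\<^sup>+y. U x * F (x + T y) \<partial>lborel) \<partial>lborel)"
    by (rule nn_integral_cong, subst nn_integral_cmult) (use shift in auto)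
  also have "\<dots> = (\<integral>\<^sup>+y. (\<integral>\<^sup>+x. U x * F (x + T y) \<partial>lborel) \<partial>lborel)"
    by (rule lborel_pair.Fubini') measurable
  also have "\<dots> = (\<integral>\<^sup>+y. (\<integral>\<^sup>+x. U (x - T y) * F x \<partial>lborel) \<partial>lborel)"
  proof (rule nn_integral_cong)
    fix y
    show "(\<integral>\<^sup>+x. U x * F (x + T y) \<partial>lborel) = (\<integral>\<^sup>+x. U (x - T y) * F x \<partial>lborel)"
      using nn_integral_lborel_translate[of "\<lambda>x. U (x - T y) * F x" "T y"] by (simp add: add.commute)
  qed
  also have "\<dots> = (\<integral>\<^sup>+x. (\<integral>\<^sup>+y. U (x - T y) * F x \<partial>lborel) \<partial>lborel)"
    by (rule lborel_pair.Fubini') measurable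
  also have "\<dots> = (\<integral>\<^sup>+x. c * F x \<partial>lborel)"
  proof (rule nn_integral_cong)
    fix x
    have "(\<integral>\<^sup>+y. U (x - T y) * F x \<partial>lborel) = (\<integral>\<^sup>+y. U (- S x + y) * F x \<partial>lborel)"
      by (simp add: U_shift)
    also have "\<dots> = (\<integral>\<^sup>+y. U (- S x + y) \<partial>lborel) * F x"
      by (subst nn_integral_multc) auto
    also have "\<dots> = c * F x"
      unfolding c_def by (subst nn_integral_lborel_translate) auto
    finally show "(\<integral>\<^sup>+y. U (x - T y) * F x \<partial>lborel) = c * F x" .
  qed
  also have "\<dots> = c * (\<integral>\<^sup>+x. F x \<partial>lborel)"
    by (subst nn_integral_cmult) auto
  finally show ?thesis
    using c_fin c_pos by (simp add: ennreal_mult_cancel_left)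
qed

lemma circle_mean_value:
  assumes "\<phi> holomorphic_on cball 0 1"
  shows "((\<lambda>t. \<phi> (exp (2 * of_real pi * \<i> * of_real t))) has_integral \<phi> 0) {0..1}"
proof -
  have "((\<lambda>u. \<phi> u / (u - 0)) has_contour_integral (2 * of_real pi * \<i> * \<phi> 0)) (circlepath 0 1)"
    by (rule Cauchy_integral_circlepath_simple) (use assms in auto)
  then have "((\<lambda>t. (2 * of_real pi * \<i>) * \<phi> (exp (2 * of_real pi * \<i> * of_real t)))
      has_integral (2 * of_real pi * \<i>) * \<phi> 0) {0..1}"
    unfolding has_contour_integral
  proof (rule has_integral_eq[rotated])
    fix t :: real assume t: "t \<in> {0..1}"
    then have "vector_derivative (circlepath 0 1) (at t) = 2 * of_real pi * \<i> * exp (2 * of_real pi * \<i> * of_real t)"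
      using vector_derivative_at[OF has_vector_derivative_circlepath[of 0 1 t UNIV]] by simp
    moreover have "circlepath 0 1 t = exp (2 * of_real pi * \<i> * of_real t)"
      by (simp add: circlepath)
    ultimately show "\<phi> (circlepath 0 1 t) / (circlepath 0 1 t - 0) * vector_derivative (circlepath 0 1) (at t)
        = (2 * of_real pi * \<i>) * \<phi> (exp (2 * of_real pi * \<i> * of_real t))"
      by simp
  qed
  from has_integral_mult_right[OF this, of "inverse (2 * of_real pi * \<i>)"]
  show ?thesis by (simp add: field_simps)
qed

text \<open>
  The real part of \<open>H = F - F(0)\<close> is below \<open>2K\<close>, so \<open>H\<close> is closer to \<open>0\<close> than to \<open>4K\<close>. Hence
  \<open>H / (4K - H)\<close> maps the disc into itself and fixes \<open>0\<close>, and the Schwarz lemma applies.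
\<close>

lemma Borel_Caratheodory_half_disc:
  assumes hol: "F holomorphic_on ball 0 1" and K: "\<And>z. norm z < 1 \<Longrightarrow> \<bar>Re (F z)\<bar> < K"
    and z: "norm z \<le> 1/2"
  shows "norm (F z - F 0) \<le> 4 * K"
proof -
  define H where "H = (\<lambda>z. F z - F 0)"
  define \<omega> where "\<omega> = (\<lambda>z. H z / (4 * K - H z))"
  have Re_H: "Re (H z) < 2 * K" if "norm z < 1" for z
    using K[of z] K[of 0] that by (simp add: H_def)
  have K_pos: "K > 0" using K[of 0] by simp
  have nz: "4 * K - H z \<noteq> 0" if "norm z < 1" for z
  proof
    assume "4 * K - H z = 0"
    then have "Re (4 * K - H z) = 0" by simp
    then show False using Re_H[OF that] K_pos by simp
  qed
  have less: "norm (H z) < norm (4 * K - H z)" if "norm z < 1" for z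
  proof -
    have "(Re (H z))\<^sup>2 < (4 * K - Re (H z))\<^sup>2"
    proof -
      have "(4 * K - Re (H z))\<^sup>2 - (Re (H z))\<^sup>2 = 8 * K * (2 * K - Re (H z))"
        by (simp add: power2_eq_square algebra_simps)
      also have "\<dots> > 0" using Re_H[OF that] K_pos by simp
      finally show ?thesis by simp
    qed
    then have "(norm (H z))\<^sup>2 < (norm (4 * K - H z))\<^sup>2"
      by (simp add: cmod_power2)
    then show ?thesis by (simp add: power_less_imp_less_base)
  qed
  have \<omega>_hol: "\<omega> holomorphic_on ball 0 1"
    unfolding \<omega>_def H_def
    by (intro holomorphic_intros hol) (use nz in \<open>auto simp: H_def\<close>)
  have "norm (\<omega> z) \<le> norm z"
  proof (rule Schwarz_Lemma(1)[OF \<omega>_hol])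
    show "\<omega> 0 = 0" by (simp add: \<omega>_def H_def)
    show "norm (\<omega> z) < 1" if "norm z < 1" for z
      using less[OF that] nz[OF that] by (simp add: \<omega>_def norm_divide divide_simps)
  qed (use z in auto)
  then have \<omega>_le: "norm (\<omega> z) \<le> 1/2" using z by simp
  have "H z = \<omega> z * (4 * K - H z)"
    using nz[of z] z by (simp add: \<omega>_def)
  then have "norm (H z) = norm (\<omega> z) * norm (4 * K - H z)"
    by (metis norm_mult)
  also have "\<dots> \<le> 1/2 * norm (4 * K - H z)"
    by (intro mult_right_mono \<omega>_le) simp
  also have "\<dots> \<le> 1/2 * (4 * K + norm (H z))"
    using norm_triangle_ineq4[of "4 * K" "H z"] K_pos by (simp add: norm_mult)
  finally show ?thesis by (simp add: H_def)
qed

text \<open>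
  The real parts of \<open>\<phi> + \<psi>\<close> and \<open>\<i>(\<phi> - \<psi>)\<close> are the real part and minus the imaginary part of
  \<open>\<phi> + cnj \<psi>\<close>.
\<close>

lemma holomorphic_part_oscillation_disc:
  assumes hol: "\<phi> holomorphic_on ball 0 1" "\<psi> holomorphic_on ball 0 1"
    and K: "\<And>z. norm z < 1 \<Longrightarrow> norm (\<phi> z + cnj (\<psi> z)) < K"
    and z: "norm z \<le> 1/2"
  shows "norm (\<phi> z - \<phi> 0) \<le> 4 * K"
proof -
  have 1: "norm ((\<phi> z + \<psi> z) - (\<phi> 0 + \<psi> 0)) \<le> 4 * K"
  proof (rule Borel_Caratheodory_half_disc[OF _ _ z])
    show "(\<lambda>z. \<phi> z + \<psi> z) holomorphic_on ball 0 1" by (intro holomorphic_intros hol)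
    show "\<bar>Re (\<phi> z + \<psi> z)\<bar> < K" if "norm z < 1" for z
      using K[OF that] abs_Re_le_cmod[of "\<phi> z + cnj (\<psi> z)"] by simp
  qed
  have 2: "norm (\<i> * (\<phi> z - \<psi> z) - \<i> * (\<phi> 0 - \<psi> 0)) \<le> 4 * K"
  proof (rule Borel_Caratheodory_half_disc[OF _ _ z])
    show "(\<lambda>z. \<i> * (\<phi> z - \<psi> z)) holomorphic_on ball 0 1" by (intro holomorphic_intros hol)
    show "\<bar>Re (\<i> * (\<phi> z - \<psi> z))\<bar> < K" if "norm z < 1" for z
      using K[OF that] abs_Im_le_cmod[of "\<phi> z + cnj (\<psi> z)"] by simp
  qed
  have "norm ((\<phi> z - \<psi> z) - (\<phi> 0 - \<psi> 0)) \<le> 4 * K"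
    using 2 by (metis mult_1 norm_ii norm_mult right_diff_distrib)
  moreover have "2 * (\<phi> z - \<phi> 0) =
      ((\<phi> z + \<psi> z) - (\<phi> 0 + \<psi> 0)) + ((\<phi> z - \<psi> z) - (\<phi> 0 - \<psi> 0))"
    by simp
  then have "2 * norm (\<phi> z - \<phi> 0) \<le>
      norm ((\<phi> z + \<psi> z) - (\<phi> 0 + \<psi> 0)) + norm ((\<phi> z - \<psi> z) - (\<phi> 0 - \<psi> 0))"
    by (metis norm_mult norm_numeral norm_triangle_ineq)
  ultimately show ?thesis using 1 by linarith
qed

section \<open>Mean values of pluriharmonic functions\<close>

lemma norm_vector_scalar_mult:
  fixes v :: "complex ^ 'n"
  shows "norm (c *s v) = norm c * norm v"
  by (simp add: norm_vec_def norm_mult L2_set_right_distrib)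

lemma linear_vector_scalar_mult:
  fixes c :: complex
  shows "linear ((*s) c :: complex ^ 'n \<Rightarrow> complex ^ 'n)"
  by (rule linearI) (simp_all add: vec_eq_iff algebra_simps)

lemma bounded_linear_vector_scalar_mult_left:
  fixes v :: "complex ^ 'n"
  shows "bounded_linear (\<lambda>c. c *s v)"
  by (subst linear_conv_bounded_linear[symmetric], rule linearI)
     (simp_all add: vec_eq_iff algebra_simps)

lemma holomorphic_on_cn_subset:
  "holomorphic_on_cn h \<Omega> \<Longrightarrow> A \<subseteq> \<Omega> \<Longrightarrow> holomorphic_on_cn h A"
  by (auto simp: holomorphic_on_cn_def)

lemma holomorphic_on_cn_imp_continuous_on:
  "holomorphic_on_cn h \<Omega> \<Longrightarrow> continuous_on \<Omega> h"
  by (metis continuous_at_imp_continuous_on has_derivative_continuous holomorphic_on_cn_def)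

lemma holomorphic_on_cn_line:
  fixes y v :: "complex ^ 'n"
  assumes h: "holomorphic_on_cn h \<Omega>" and A: "\<And>\<zeta>. \<zeta> \<in> A \<Longrightarrow> y + \<zeta> *s v \<in> \<Omega>"
  shows "(\<lambda>\<zeta>. h (y + \<zeta> *s v)) holomorphic_on A"
  unfolding holomorphic_on_def
proof
  fix \<zeta> assume "\<zeta> \<in> A"
  then obtain D where D: "(h has_derivative D) (at (y + \<zeta> *s v))"
    and D_complex: "\<And>c v. D (c *s v) = c * D v"
    using h A unfolding holomorphic_on_cn_def by blast
  have "((\<lambda>\<zeta>. y + \<zeta> *s v) has_derivative (\<lambda>\<zeta>. \<zeta> *s v)) (at \<zeta> within A)"
    using has_derivative_add[OF has_derivative_const
        bounded_linear_imp_has_derivative[OF bounded_linear_vector_scalar_mult_left]]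
    by fastforce
  from has_derivative_compose[OF this D]
  have "((\<lambda>\<zeta>. h (y + \<zeta> *s v)) has_derivative (\<lambda>\<zeta>. D v * \<zeta>)) (at \<zeta> within A)"
    by (simp add: D_complex mult.commute)
  then show "(\<lambda>\<zeta>. h (y + \<zeta> *s v)) field_differentiable at \<zeta> within A"
    unfolding field_differentiable_def has_field_derivative_def by blast
qed

text \<open>
  Restricted to the complex line through \<open>y\<close> in direction \<open>v\<close>, both \<open>h\<close> and \<open>g\<close> have the mean value
  property on circles, and complex conjugation respects it.
\<close>

lemma sub_mean_value_circle:
  fixes y v :: "complex ^ 'n"
  assumes h: "holomorphic_on_cn h (ball y \<rho>)" and g: "holomorphic_on_cn g (ball y \<rho>)"
    and v: "norm v < \<rho>"
  shows "ennreal (norm (h y + cnj (g y))) \<le>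
    (\<integral>\<^sup>+t\<in>{0..1}. ennreal (norm (h (y + exp (2 * of_real pi * \<i> * of_real t) *s v) +
      cnj (g (y + exp (2 * of_real pi * \<i> * of_real t) *s v)))) \<partial>lborel)"
proof -
  let ?e = "\<lambda>t::real. exp (2 * of_real pi * \<i> * of_real t)"
  define f where "f = (\<lambda>z. h z + cnj (g z))"
  have norm_e: "norm (?e t) = 1" for t
    using norm_exp_i_times[of "2 * pi * t"] by (simp add: mult_ac)
  have mem: "y + \<zeta> *s v \<in> ball y \<rho>" if "\<zeta> \<in> cball 0 1" for \<zeta>
  proof -
    have "norm \<zeta> * norm v \<le> 1 * norm v" using that by (intro mult_right_mono) auto
    then show ?thesis using v by (simp add: dist_norm norm_vector_scalar_mult)
  qed
  have h_mean: "((\<lambda>t. h (y + ?e t *s v)) has_integral h y) {0..1}"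
    using circle_mean_value[OF holomorphic_on_cn_line[OF h mem]] by simp
  have g_mean: "((\<lambda>t. g (y + ?e t *s v)) has_integral g y) {0..1}"
    using circle_mean_value[OF holomorphic_on_cn_line[OF g mem]] by simp
  have f_mean: "((\<lambda>t. f (y + ?e t *s v)) has_integral f y) {0..1}"
    unfolding f_def by (intro has_integral_add h_mean) (use g_mean in \<open>simp add: has_integral_cnj[unfolded o_def]\<close>)
  have cont: "continuous_on {0..1} (\<lambda>t. f (y + ?e t *s v))"
  proof -
    have "continuous_on (ball y \<rho>) f" unfolding f_def
      by (intro continuous_intros holomorphic_on_cn_imp_continuous_on h g)
    moreover have "continuous_on {0..1} (\<lambda>t. y + ?e t *s v)"
      by (intro continuous_intros bounded_linear.continuous_on[OF bounded_linear_vector_scalar_mult_left])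
    ultimately show ?thesis
      by (rule continuous_on_compose2) (use mem norm_e in auto)
  qed
  define I where "I = integral {0..1} (\<lambda>t. norm (f (y + ?e t *s v)))"
  have norm_int: "(\<lambda>t. norm (f (y + ?e t *s v))) integrable_on {0..1}"
    by (intro integrable_continuous_interval continuous_intros cont)
  have "norm (f y) = norm (integral {0..1} (\<lambda>t. f (y + ?e t *s v)))"
    using f_mean by (simp add: integral_unique)
  also have "\<dots> \<le> I" unfolding I_def
    by (rule integral_norm_bound_integral)
       (use f_mean norm_int in \<open>auto simp: has_integral_integrable\<close>)
  finally have "ennreal (norm (f y)) \<le> ennreal I" by (rule ennreal_leI)
  also have "ennreal I = (\<integral>\<^sup>+t\<in>{0..1}. ennreal (norm (f (y + ?e t *s v))) \<partial>lborel)"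
    unfolding I_def
    by (intro nn_integral_has_integral_lebesgue'[symmetric] integrable_integral norm_int) simp
  finally show ?thesis by (simp add: f_def)
qed

text \<open>
  Averaging the circle inequality over all directions \<open>v\<close> in the ball and exchanging the integrals,
  each rotation \<open>v \<mapsto> e\<^sup>i\<^sup>t v\<close> preserves Lebesgue measure, so that only the integral over the ball
  remains.
\<close>

lemma sub_mean_value_ball:
  fixes y :: "complex ^ 'n"
  assumes h: "holomorphic_on_cn h (ball y \<rho>)" and g: "holomorphic_on_cn g (ball y \<rho>)"
  shows "ennreal (norm (h y + cnj (g y))) * emeasure lborel (ball y \<rho>) \<le>
    (\<integral>\<^sup>+x\<in>ball y \<rho>. ennreal (norm (h x + cnj (g x))) \<partial>lborel)"
proof -
  let ?e = "\<lambda>t::real. exp (2 * of_real pi * \<i> * of_real t)"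
  define f where "f = (\<lambda>z. h z + cnj (g z))"
  define F where "F = (\<lambda>x. ennreal (norm (f x)) * indicator (ball y \<rho>) x)"
  define F0 where "F0 = (\<lambda>v. F (y + v))"
  have norm_e: "norm (?e t) = 1" for t
    using norm_exp_i_times[of "2 * pi * t"] by (simp add: mult_ac)
  have F [measurable]: "F \<in> borel_measurable borel"
  proof -
    have "(\<lambda>x. indicator (ball y \<rho>) x *\<^sub>R norm (f x)) \<in> borel_measurable borel"
      unfolding f_def
      by (intro borel_measurable_continuous_on_indicator continuous_intros
          holomorphic_on_cn_imp_continuous_on h g) simp
    then have "(\<lambda>x. ennreal (indicator (ball y \<rho>) x *\<^sub>R norm (f x))) \<in> borel_measurable borel"
      by measurable
    also have "(\<lambda>x. ennreal (indicator (ball y \<rho>) x *\<^sub>R norm (f x))) = F"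
      by (auto simp: F_def fun_eq_iff indicator_def)
    finally show ?thesis .
  qed
  have F0 [measurable]: "F0 \<in> borel_measurable borel" unfolding F0_def by measurable
  have rot_meas: "(\<lambda>(v :: complex ^ 'n, t). ?e t *s v) \<in> borel_measurable (lborel \<Otimes>\<^sub>M lborel)"
  proof -
    have "continuous_on UNIV (\<lambda>p :: (complex ^ 'n) \<times> real. ?e (snd p) *s fst p)"
      unfolding vector_scalar_mult_def by (intro continuous_intros)
    then have "(\<lambda>p :: (complex ^ 'n) \<times> real. ?e (snd p) *s fst p) \<in> borel_measurable borel"
      by (rule borel_measurable_continuous_onI)
    then show ?thesis
      by (simp add: case_prod_beta' lborel_prod)
  qed
  have [measurable]: "(\<lambda>(v, t). indicator {0..1} t * F0 (?e t *s v)) \<in> borel_measurable (lborel \<Otimes>\<^sub>M lborel)"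
    using measurable_compose[OF rot_meas F0] by (simp add: case_prod_beta') measurable
  have point: "ennreal (norm (f y)) * indicator (ball 0 \<rho>) v
      \<le> (\<integral>\<^sup>+t. indicator {0..1} t * F0 (?e t *s v) \<partial>lborel)" for v
  proof (cases "norm v < \<rho>")
    case True
    have "(\<integral>\<^sup>+t. indicator {0..1} t * F0 (?e t *s v) \<partial>lborel) =
      (\<integral>\<^sup>+t\<in>{0..1}. ennreal (norm (f (y + ?e t *s v))) \<partial>lborel)"
      using True by (intro nn_integral_cong)
        (auto simp: F0_def F_def dist_norm norm_vector_scalar_mult norm_e mult.commute)
    then show ?thesis
      using sub_mean_value_circle[OF h g True] True by (simp add: f_def)
  qed auto
  have "ennreal (norm (f y)) * emeasure lborel (ball y \<rho>)
      = ennreal (norm (f y)) * emeasure lborel (ball (0::complex ^ 'n) \<rho>)"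
    by (cases "\<rho> \<ge> 0") (auto simp: emeasure_ball ball_empty)
  also have "\<dots> = (\<integral>\<^sup>+v. ennreal (norm (f y)) * indicator (ball 0 \<rho>) v \<partial>(lborel :: (complex ^ 'n) measure))"
    by (subst nn_integral_cmult_indicator) auto
  also have "\<dots> \<le> (\<integral>\<^sup>+v. (\<integral>\<^sup>+t. indicator {0..1} t * F0 (?e t *s v) \<partial>lborel) \<partial>lborel)"
    by (intro nn_integral_mono point)
  also have "\<dots> = (\<integral>\<^sup>+t. (\<integral>\<^sup>+v. indicator {0..1} t * F0 (?e t *s v) \<partial>lborel) \<partial>lborel)"
    by (rule lborel_pair.Fubini'[symmetric]) measurable
  also have "\<dots> = (\<integral>\<^sup>+t. indicator {0..1} t * (\<integral>\<^sup>+v. F0 v \<partial>lborel) \<partial>(lborel :: real measure))"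
  proof (rule nn_integral_cong)
    fix t
    have "(\<integral>\<^sup>+v. F0 (?e t *s v) \<partial>lborel) = (\<integral>\<^sup>+v. F0 v \<partial>lborel)"
    proof (rule nn_integral_lborel_isometry[OF F0 linear_vector_scalar_mult])
      show "?e t *s (exp (- (2 * of_real pi * \<i> * of_real t)) *s x) = x" for x :: "complex ^ 'n"
        by (simp add: exp_add[symmetric])
    qed (simp add: norm_vector_scalar_mult norm_e)
    moreover have "(\<lambda>v. F0 (?e t *s v)) \<in> borel_measurable lborel"
      using linear_vector_scalar_mult[of "?e t"]
      by (intro measurable_compose[OF _ F0])
         (auto intro!: borel_measurable_continuous_onI linear_continuous_on simp: linear_conv_bounded_linear)
    ultimately show "(\<integral>\<^sup>+v. indicator {0..1} t * F0 (?e t *s v) \<partial>lborel) = indicator {0..1} t * (\<integral>\<^sup>+v. F0 v \<partial>lborel)"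
      by (simp add: nn_integral_cmult)
  qed
  also have "\<dots> = (\<integral>\<^sup>+v. F0 v \<partial>lborel)"
    by (subst nn_integral_multc) auto
  also have "\<dots> = (\<integral>\<^sup>+x. F x \<partial>lborel)"
    unfolding F0_def by (rule nn_integral_lborel_translate) measurable
  finally show ?thesis by (simp add: f_def F_def)
qed

section \<open>Local estimates without weight\<close>

text \<open>
  Trades an exponent \<open>1\<close> for an arbitrary exponent \<open>s > 0\<close>, at the cost of an additive term that can be
  absorbed: above the level \<open>t/2\<close>, the quotient \<open>u/t\<close> lies in \<open>[1/2, K]\<close>, where \<open>(u/t)\<^sup>1\<^sup>-\<^sup>s\<close> is
  bounded.
\<close>

lemma le_half_plus_powr:
  fixes s K :: real
  assumes "s > 0" "K > 0"
  obtains c where "c > 0"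
    "\<And>t u. 0 < t \<Longrightarrow> 0 \<le> u \<Longrightarrow> u \<le> K * t \<Longrightarrow> u \<le> t / 2 + c * t powr (1 - s) * u powr s"
proof
  define c where "c = max ((1/2) powr (1 - s)) (K powr (1 - s))"
  show "c > 0" by (simp add: c_def less_max_iff_disj)
  fix t u :: real assume t: "0 < t" and u: "0 \<le> u" "u \<le> K * t"
  show "u \<le> t / 2 + c * t powr (1 - s) * u powr s"
  proof (cases "u \<le> t / 2")
    case True
    then show ?thesis using \<open>c > 0\<close> by (simp add: add_increasing2)
  next
    case False
    then have u_pos: "u > 0" using t by auto
    have "(u / t) powr (1 - s) \<le> c"
    proof (cases "s \<le> 1")
      case True
      then have "(u / t) powr (1 - s) \<le> K powr (1 - s)"
        using t u u_pos by (intro powr_mono2) (auto simp: field_simps)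
      then show ?thesis by (simp add: c_def)
    next
      case s: False
      have "(u / t) powr (1 - s) \<le> (1/2) powr (1 - s)"
        using t u u_pos False s by (intro powr_mono2') (auto simp: field_simps)
      then show ?thesis by (simp add: c_def)
    qed
    then have "u powr (1 - s) \<le> c * t powr (1 - s)"
      using t u_pos by (simp add: powr_divide field_simps)
    then have "u powr (1 - s) * u powr s \<le> c * t powr (1 - s) * u powr s"
      by (rule mult_right_mono) simp
    then have "u \<le> c * t powr (1 - s) * u powr s"
      using u_pos by (simp flip: powr_add)
    then show ?thesis using t by simp
  qed
qed

text \<open>
  The inequality of Hardy and Littlewood for powers of harmonic functions. For \<open>s < 1\<close> the function
  \<open>\<bar>f\<bar>\<^sup>s\<close> need not be subharmonic. Choose \<open>y\<^sub>0\<close> where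
  \<open>\<bar>f(z)\<bar>\<^sup>s (R - \<bar>x - z\<bar>)\<^sup>N\<close> is maximal. On the ball about \<open>y\<^sub>0\<close> whose radius \<open>\<rho>\<close> is half the distance
  to the boundary, the weight decreases at most by the factor \<open>2\<^sup>N\<close>, hence \<open>\<bar>f\<bar> \<le> K \<bar>f(y\<^sub>0)\<bar>\<close> there
  with \<open>K = 2\<^sup>N\<^sup>/\<^sup>s\<close>. The mean value inequality with exponent \<open>1\<close> at \<open>y\<^sub>0\<close> can then be converted to
  exponent \<open>s\<close>, and maximality carries the result from \<open>y\<^sub>0\<close> to all \<open>y\<close> in the half-size ball.
\<close>

lemma pluriharmonic_power_sub_mean_value:
  fixes s :: real
  assumes s: "s > 0"
  obtains c where "c > 0"
    "\<And>h g (x :: complex ^ 'n) R y. holomorphic_on_cn h (cball x R) \<Longrightarrow> holomorphic_on_cn g (cball x R) \<Longrightarrow>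
      R > 0 \<Longrightarrow> y \<in> cball x (R / 2) \<Longrightarrow>
      ennreal (c * R ^ DIM(complex ^ 'n) * norm (h y + cnj (g y)) powr s) \<le>
        (\<integral>\<^sup>+z\<in>cball x R. ennreal (norm (h z + cnj (g z)) powr s) \<partial>lborel)"
proof -
  define N where "N = DIM(complex ^ 'n)"
  define v where "v = unit_ball_vol (real N)"
  have v: "v > 0" by (simp add: v_def)
  \<comment> \<open>Chosen so that \<open>\<bar>f(z)\<bar>\<^sup>s \<le> 2\<^sup>N \<bar>f(y\<^sub>0)\<bar>\<^sup>s\<close> means \<open>\<bar>f(z)\<bar> \<le> K \<bar>f(y\<^sub>0)\<bar>\<close>.\<close>
  define K :: real where "K = 2 powr (N / s)"
  have K: "K > 0" by (simp add: K_def)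
  obtain c1 where c1: "c1 > 0"
    "\<And>t u. 0 < t \<Longrightarrow> 0 \<le> u \<Longrightarrow> u \<le> K * t \<Longrightarrow> u \<le> t / 2 + c1 * t powr (1 - s) * u powr s"
    using le_half_plus_powr[OF s K] by blast
  define c where "c = v / (2 * c1 * 4 ^ N)"
  show ?thesis
  proof (rule that[folded N_def])
    show "c > 0" using v c1 by (simp add: c_def)
    fix h g :: "complex ^ 'n \<Rightarrow> complex" and x y :: "complex ^ 'n" and R :: real
    assume h: "holomorphic_on_cn h (cball x R)" and g: "holomorphic_on_cn g (cball x R)"
      and R: "R > 0" and y: "y \<in> cball x (R / 2)"
    have y_mem: "y \<in> cball x R" using y R by simp
    define f where "f = (\<lambda>z. h z + cnj (g z))"
    have f_cont: "continuous_on (cball x R) f"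
      unfolding f_def by (intro continuous_intros holomorphic_on_cn_imp_continuous_on h g)
    define \<Phi> where "\<Phi> = (\<lambda>z. norm (f z) powr s * (R - dist x z) ^ N)"
    have "continuous_on (cball x R) \<Phi>"
      unfolding \<Phi>_def using s
      by (intro continuous_intros f_cont continuous_on_powr') auto
    then obtain y0 where y0: "y0 \<in> cball x R" and max: "\<And>z. z \<in> cball x R \<Longrightarrow> \<Phi> z \<le> \<Phi> y0"
      using continuous_attains_sup[of "cball x R" \<Phi>] R by fastforce
    define t where "t = norm (f y0)"
    define \<rho> where "\<rho> = (R - dist x y0) / 2"
    have \<Phi>_y: "norm (f y) powr s * (R / 2) ^ N \<le> \<Phi> y"
      unfolding \<Phi>_def using y R by (intro mult_left_mono power_mono) auto
    show "ennreal (c * R ^ N * norm (h y + cnj (g y)) powr s) \<le>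
        (\<integral>\<^sup>+z\<in>cball x R. ennreal (norm (h z + cnj (g z)) powr s) \<partial>lborel)"
    proof (cases "f y = 0")
      case True
      then show ?thesis using s by (simp add: f_def)
    next
      case False
      then have \<Phi>_pos: "\<Phi> y0 > 0"
      proof -
        have "0 < norm (f y) powr s * (R / 2) ^ N" using False R by simp
        then show ?thesis using \<Phi>_y max[OF y_mem] by linarith
      qed
      have \<rho>: "\<rho> > 0"
      proof -
        have "N > 0" unfolding N_def by (rule DIM_positive)
        then have "dist x y0 \<noteq> R" using \<Phi>_pos by (auto simp: \<Phi>_def zero_power)
        then show ?thesis using y0 by (simp add: \<rho>_def)
      qed
      have t: "t > 0"
        using \<Phi>_pos s unfolding \<Phi>_def t_def by (cases "f y0 = 0") auto
      have sub: "ball y0 \<rho> \<subseteq> cball x R"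
      proof
        fix z assume "z \<in> ball y0 \<rho>"
        then show "z \<in> cball x R"
          using dist_triangle[of x z y0] \<rho> by (simp add: \<rho>_def)
      qed
      have f_le: "norm (f z) \<le> K * t" if z: "z \<in> ball y0 \<rho>" for z
      proof -
        have "\<rho> \<le> R - dist x z"
          using z dist_triangle[of x z y0] by (simp add: \<rho>_def)
        then have "norm (f z) powr s * \<rho> ^ N \<le> \<Phi> z"
          unfolding \<Phi>_def using \<rho> by (intro mult_left_mono power_mono) auto
        also have "\<dots> \<le> \<Phi> y0" using max sub z by blast
        also have "\<dots> = t powr s * 2 ^ N * \<rho> ^ N"
          by (simp add: \<Phi>_def t_def \<rho>_def power_divide)
        finally have "norm (f z) powr s \<le> 2 ^ N * t powr s"
          using \<rho> by (simp add: mult_ac)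
        also have "\<dots> = (K * t) powr s"
          using s t by (simp add: K_def powr_mult powr_powr powr_realpow)
        finally show ?thesis
          using s K t by (meson mult_pos_pos linorder_not_le norm_ge_zero powr_less_mono2 less_eq_real_def)
      qed
      \<comment> \<open>Exponent \<open>1\<close> is exchanged for \<open>s\<close>: half of the mean value inequality is absorbed.\<close>
      define J where "J = (\<integral>\<^sup>+z\<in>ball y0 \<rho>. ennreal (norm (f z) powr s) \<partial>lborel)"
      have J_le: "J \<le> (\<integral>\<^sup>+z\<in>cball x R. ennreal (norm (f z) powr s) \<partial>lborel)"
        unfolding J_def using sub by (intro nn_integral_mono) (auto simp: indicator_def)
      have meas [measurable]: "(\<lambda>z. ennreal (norm (f z) powr s) * indicator (ball y0 \<rho>) z) \<in> borel_measurable lborel"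
      proof -
        have "continuous_on (ball y0 \<rho>) (\<lambda>z. norm (f z) powr s)"
          using s by (intro continuous_intros continuous_on_powr' continuous_on_subset[OF f_cont sub]) auto
        then have "(\<lambda>z. indicator (ball y0 \<rho>) z *\<^sub>R (norm (f z) powr s)) \<in> borel_measurable borel"
          by (intro borel_measurable_continuous_on_indicator) simp
        then have "(\<lambda>z. ennreal (indicator (ball y0 \<rho>) z *\<^sub>R (norm (f z) powr s))) \<in> borel_measurable borel"
          by measurable
        also have "(\<lambda>z. ennreal (indicator (ball y0 \<rho>) z *\<^sub>R (norm (f z) powr s)))
            = (\<lambda>z. ennreal (norm (f z) powr s) * indicator (ball y0 \<rho>) z)"
          by (auto simp: fun_eq_iff indicator_def)
        finally show ?thesis by simp
      qed
      have vol: "emeasure lborel (ball y0 \<rho>) = ennreal (v * \<rho> ^ N)"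
        using \<rho> by (simp add: emeasure_ball v_def N_def)
      have main: "ennreal (v * \<rho> ^ N * t powr s) \<le> ennreal (2 * c1) * J"
      proof (cases "J = \<infinity>")
        case True
        then show ?thesis using c1 by (simp add: ennreal_mult_top)
      next
        case False
        then obtain j where j: "J = ennreal j" "j \<ge> 0"
          by (metis ennreal_cases infinity_ennreal_def)
        have "ennreal t * emeasure lborel (ball y0 \<rho>) \<le> (\<integral>\<^sup>+z\<in>ball y0 \<rho>. ennreal (norm (f z)) \<partial>lborel)"
          unfolding t_def f_def
          by (rule sub_mean_value_ball; rule holomorphic_on_cn_subset[OF _ sub]; fact)
        also have "\<dots> \<le> (\<integral>\<^sup>+z. ennreal (t / 2) * indicator (ball y0 \<rho>) z +
            ennreal (c1 * t powr (1 - s)) * (ennreal (norm (f z) powr s) * indicator (ball y0 \<rho>) z) \<partial>lborel)"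
        proof (intro nn_integral_mono)
          fix z
          have "ennreal (norm (f z)) \<le> ennreal (t / 2) + ennreal (c1 * t powr (1 - s)) * ennreal (norm (f z) powr s)"
            if "z \<in> ball y0 \<rho>"
            using c1(2)[OF t _ f_le[OF that]] t c1(1)
            by (simp flip: ennreal_plus ennreal_mult add: ennreal_leI mult_ac)
          then show "ennreal (norm (f z)) * indicator (ball y0 \<rho>) z \<le> ennreal (t / 2) * indicator (ball y0 \<rho>) z +
            ennreal (c1 * t powr (1 - s)) * (ennreal (norm (f z) powr s) * indicator (ball y0 \<rho>) z)"
            by (auto simp: indicator_def)
        qed
        also have "\<dots> = ennreal (t / 2) * emeasure lborel (ball y0 \<rho>) + ennreal (c1 * t powr (1 - s)) * J"
        proof -
          have "(\<lambda>z. ennreal (t / 2) * indicator (ball y0 \<rho>) z) \<in> borel_measurable lborel"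
            by (intro borel_measurable_times_ennreal borel_measurable_const borel_measurable_indicator) simp
          moreover have "(\<lambda>z. ennreal (c1 * t powr (1 - s)) * (ennreal (norm (f z) powr s) * indicator (ball y0 \<rho>) z))
              \<in> borel_measurable lborel"
            by (intro borel_measurable_times_ennreal[OF borel_measurable_const] meas)
          ultimately show ?thesis
            unfolding J_def by (simp add: nn_integral_add nn_integral_cmult[OF meas] nn_integral_cmult_indicator del: mem_ball)
        qed
        finally have "ennreal (t * (v * \<rho> ^ N)) \<le> ennreal (t / 2 * (v * \<rho> ^ N) + c1 * t powr (1 - s) * j)"
          using t v \<rho> c1(1) j
          by (subst ennreal_plus) (simp_all add: vol ennreal_mult' del: times_divide_eq_left)
        then have "t * (v * \<rho> ^ N) \<le> t / 2 * (v * \<rho> ^ N) + c1 * t powr (1 - s) * j"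
          using t v \<rho> c1(1) j by (subst (asm) ennreal_le_iff) auto
        then have "t * (v * \<rho> ^ N) \<le> 2 * c1 * j * t powr (1 - s)"
          by (simp add: algebra_simps)
        then have "t powr (s - 1) * (t * (v * \<rho> ^ N)) \<le> t powr (s - 1) * (2 * c1 * j * t powr (1 - s))"
          by (rule mult_left_mono) simp
        moreover have t_powr: "t powr s = t powr (s - 1) * t"
          using t powr_add[of t "s - 1" 1] by simp
        have "t powr (s - 1) * (t * (v * \<rho> ^ N)) = v * \<rho> ^ N * t powr s"
          unfolding t_powr by (simp only: mult_ac)
        moreover have "t powr (s - 1) * (2 * c1 * j * t powr (1 - s)) = 2 * c1 * j * (t powr (s - 1) * t powr (1 - s))"
          by (simp only: mult_ac)
        moreover have "t powr (s - 1) * t powr (1 - s) = 1"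
          using t by (simp flip: powr_add)
        ultimately have "v * \<rho> ^ N * t powr s \<le> 2 * c1 * j"
          by simp
        then show ?thesis using j c1(1) by (simp flip: ennreal_mult add: ennreal_leI)
      qed
      have "R ^ N * norm (f y) powr s \<le> 4 ^ N * (\<rho> ^ N * t powr s)"
      proof -
        have "norm (f y) powr s * (R / 2) ^ N \<le> \<Phi> y0"
          using \<Phi>_y max[OF y_mem] by linarith
        also have "\<dots> = t powr s * 2 ^ N * \<rho> ^ N"
          by (simp add: \<Phi>_def t_def \<rho>_def power_divide)
        finally have "norm (f y) powr s * R ^ N \<le> (2 ^ N * 2 ^ N) * (\<rho> ^ N * t powr s)"
          by (simp add: power_divide field_simps)
        also have "(2 ^ N * 2 ^ N) = (4 ^ N :: real)"
          by (simp flip: power_mult_distrib)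
        finally show ?thesis by (simp add: mult_ac)
      qed
      then have "c * (R ^ N * norm (f y) powr s) \<le> c * (4 ^ N * (\<rho> ^ N * t powr s))"
        using \<open>c > 0\<close> by (intro mult_left_mono) auto
      also have "\<dots> = v * \<rho> ^ N * t powr s / (2 * c1)"
        using c1(1) by (simp add: c_def)
      finally have "2 * c1 * (c * R ^ N * norm (f y) powr s) \<le> v * \<rho> ^ N * t powr s"
        using c1(1) by (simp add: field_simps)
      then have "ennreal (2 * c1) * ennreal (c * R ^ N * norm (f y) powr s) \<le> ennreal (2 * c1) * J"
        using main c1(1) \<open>c > 0\<close> R
        by (simp flip: ennreal_mult) (meson dual_order.trans ennreal_leI)
      then have "ennreal (c * R ^ N * norm (f y) powr s) \<le> J"
        using c1(1) by (subst (asm) ennreal_mult_le_mult_iff) auto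
      then show ?thesis using J_le by (simp add: f_def)
    qed
  qed
qed

text \<open>
  Rescaled to the unit disc, this is the one-variable estimate on the complex line through \<open>x\<close> and
  \<open>y\<close>.
\<close>

lemma holomorphic_part_oscillation:
  fixes x y :: "complex ^ 'n"
  assumes h: "holomorphic_on_cn h (ball x r)" and g: "holomorphic_on_cn g (ball x r)"
    and m: "\<And>z. z \<in> ball x r \<Longrightarrow> norm (h z + cnj (g z)) \<le> m" and y: "y \<in> ball x (r / 2)"
  shows "norm (h y - h x) \<le> 4 * m"
proof (cases "y = x")
  case True
  have "r > 0" using y True by simp
  then have "0 \<le> m" using m[of x] norm_ge_zero[of "h x + cnj (g x)"] by (simp del: norm_ge_zero)
  then show ?thesis using True by simp
next
  case False
  have r: "r > 0" using y zero_le_dist[of x y] by (simp del: zero_le_dist)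
  define u where "u = y - x"
  have u: "norm u > 0" "x + u = y" using False by (auto simp: u_def)
  define v where "v = of_real (r / norm u) *s u"
  define \<zeta> where "\<zeta> = complex_of_real (norm u / r)"
  have norm_v: "norm v = r"
    using u r by (simp add: v_def norm_vector_scalar_mult norm_divide)
  have y_eq: "x + \<zeta> *s v = y"
  proof -
    have "\<zeta> * of_real (r / norm u) = 1"
      unfolding \<zeta>_def of_real_mult[symmetric] using u r by simp
    then have "\<zeta> *s v = u" by (simp only: v_def vector_smult_assoc vector_smult_lid)
    then show ?thesis using u by simp
  qed
  have \<zeta>: "norm \<zeta> \<le> 1 / 2"
    unfolding \<zeta>_def norm_of_real using y r
    by (simp add: u_def dist_norm norm_minus_commute field_simps)
  have mem: "x + w *s v \<in> ball x r" if "w \<in> ball 0 1" for w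
    using that r by (simp add: dist_norm norm_vector_scalar_mult norm_v)
  \<comment> \<open>The one-variable estimate needs a strict bound, so \<open>m\<close> is approached from above.\<close>
  have "norm (h y - h x) \<le> 4 * K" if K: "K > m" for K
  proof -
    have "norm (h (x + \<zeta> *s v) - h (x + 0 *s v)) \<le> 4 * K"
    proof (rule holomorphic_part_oscillation_disc[OF _ _ _ \<zeta>])
      show "norm (h (x + z *s v) + cnj (g (x + z *s v))) < K" if "norm z < 1" for z
        using m[OF mem, of z] that K by simp
    qed (rule holomorphic_on_cn_line[OF h mem] holomorphic_on_cn_line[OF g mem], assumption)+
    then show ?thesis by (simp add: y_eq)
  qed
  then have "norm (h y - h x) / 4 \<le> K" if "K > m" for K using that by fastforce
  then have "norm (h y - h x) / 4 \<le> m" by (rule dense_ge)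
  then show ?thesis by simp
qed

section \<open>Muckenhoupt weights\<close>

lemma weight_borel_measurable:
  fixes \<omega> :: "complex ^ 'n \<Rightarrow> real"
  assumes "weight \<omega>"
  shows "\<omega> \<in> borel_measurable lebesgue"
proof (rule borel_measurable_LIMSEQ_real)
  fix n :: nat
  have "\<omega> absolutely_integrable_on cball 0 (real n)"
    using assms by (simp add: weight_def)
  then show "(\<lambda>x. indicator (cball 0 (real n)) x *\<^sub>R \<omega> x) \<in> borel_measurable lebesgue"
    unfolding set_integrable_def by (rule borel_measurable_integrable)
next
  fix x :: "complex ^ 'n"
  obtain n where n: "norm x \<le> real n" using real_arch_simple by blast
  have "\<forall>\<^sub>F k in sequentially. indicator (cball 0 (real k)) x *\<^sub>R \<omega> x = \<omega> x"
    using eventually_ge_at_top[of n] by eventually_elim (use n in auto)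
  then show "(\<lambda>k. indicator (cball 0 (real k)) x *\<^sub>R \<omega> x) \<longlonglongrightarrow> \<omega> x"
    by (rule tendsto_eventually)
qed

definition weighted_lebesgue :: "(complex ^ 'n \<Rightarrow> real) \<Rightarrow> (complex ^ 'n) measure"
  where "weighted_lebesgue \<omega> = density lebesgue (\<lambda>x. ennreal (\<omega> x))"

lemma sets_weighted_lebesgue [simp, measurable_cong]: "sets (weighted_lebesgue \<omega>) = sets lebesgue"
  and space_weighted_lebesgue [simp]: "space (weighted_lebesgue \<omega>) = UNIV"
  by (simp_all add: weighted_lebesgue_def)

lemma nn_integral_weighted_lebesgue:
  assumes \<omega>: "weight \<omega>" and F: "F \<in> borel_measurable lebesgue"
  shows "(\<integral>\<^sup>+x. F x \<partial>weighted_lebesgue \<omega>) = (\<integral>\<^sup>+x. ennreal (\<omega> x) * F x \<partial>lebesgue)"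
  unfolding weighted_lebesgue_def
  using weight_borel_measurable[OF \<omega>] F by (intro nn_integral_density) auto

lemma emeasure_weighted_ball_finite:
  assumes \<omega>: "weight \<omega>"
  shows "emeasure (weighted_lebesgue \<omega>) (ball a r) < \<infinity>"
proof -
  have "set_integrable lebesgue (cball a r) \<omega>"
    using \<omega> by (simp add: weight_def)
  then have "(\<integral>\<^sup>+x. ennreal (norm (indicator (cball a r) x *\<^sub>R \<omega> x)) \<partial>lebesgue) < \<infinity>"
    unfolding set_integrable_def by (simp add: integrable_iff_bounded)
  moreover have "(\<integral>\<^sup>+x. ennreal (\<omega> x) * indicator (ball a r) x \<partial>lebesgue)
      \<le> (\<integral>\<^sup>+x. ennreal (norm (indicator (cball a r) x *\<^sub>R \<omega> x)) \<partial>lebesgue)"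
    by (intro nn_integral_mono) (auto simp: indicator_def intro!: ennreal_leI)
  ultimately show ?thesis
    unfolding weighted_lebesgue_def
    using weight_borel_measurable[OF \<omega>] by (subst emeasure_density) (auto elim: le_less_trans)
qed

lemma nn_integral_AE_pos_ball:
  fixes a :: "'a::euclidean_space"
  assumes F: "F \<in> borel_measurable lebesgue" and pos: "AE x in lebesgue. F x > (0::ennreal)" and r: "r > 0"
  shows "(\<integral>\<^sup>+x\<in>ball a r. F x \<partial>lebesgue) \<noteq> 0"
proof
  assume "(\<integral>\<^sup>+x\<in>ball a r. F x \<partial>lebesgue) = 0"
  moreover have "(\<lambda>x. F x * indicator (ball a r) x) \<in> borel_measurable lebesgue"
    by (intro borel_measurable_times_ennreal F borel_measurable_indicator) simp
  ultimately have "AE x in lebesgue. F x * indicator (ball a r) x = 0"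
    by (simp add: nn_integral_0_iff_AE)
  then have "AE x in lebesgue. x \<notin> ball a r"
    using pos by eventually_elim (auto simp: indicator_def split: if_splits)
  then have "emeasure lebesgue (ball a r) = 0"
    by (subst (asm) AE_iff_measurable[of "ball a r"]) auto
  then show False
    using r unit_ball_vol_pos[of "DIM('a)"] by (simp add: emeasure_ball del: unit_ball_vol_pos)
qed

text \<open>
  This is how the Muckenhoupt condition is used throughout. In terms of integrals it says that
  \<open>(\<integral>\<^sub>Q F\<^sup>1\<^sup>/\<^sup>q)\<^sup>q W(Q) \<le> 2\<^sup>q M \<bar>Q\<bar>\<^sup>q \<integral>\<^sub>Q F dW\<close>; a lower bound \<open>m\<close> replaces the integral on the left, so
  that no power of a possibly infinite quantity occurs. Write
  \<open>F\<^sup>1\<^sup>/\<^sup>q = (F \<omega>)\<^sup>1\<^sup>/\<^sup>q \<sigma>\<^sup>1\<^sup>-\<^sup>1\<^sup>/\<^sup>q\<close> with \<open>\<sigma> = \<omega>\<^sup>1\<^sup>/\<^sup>(\<^sup>1\<^sup>-\<^sup>q\<^sup>)\<close>; by Hoelder's inequality the left-hand integral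
  is controlled by \<open>X = \<integral>\<^sub>Q F dW\<close> and \<open>Y = \<integral>\<^sub>Q \<sigma>\<close>, and the Muckenhoupt condition bounds \<open>Y\<close>.
  Hoelder's inequality is obtained from Young's inequality for the normalised functions \<open>F \<omega> / X\<close> and
  \<open>\<sigma> / Y\<close>. Bounding both weights in Young's inequality by \<open>1\<close> costs the factor \<open>2\<^sup>q\<close>.
\<close>

lemma muckenhoupt_holder:
  fixes a :: "complex ^ 'n"
  assumes A: "muckenhoupt q M \<omega>" and q: "q > 1" and M: "M \<ge> 1" and r: "r > 0"
    and F: "F \<in> borel_measurable lebesgue" and F_nonneg: "\<And>x. 0 \<le> F x"
    and m: "m \<ge> 0" "ennreal m \<le> (\<integral>\<^sup>+x\<in>ball a r. ennreal (F x powr (1 / q)) \<partial>lebesgue)"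
  shows "ennreal (m powr q) * emeasure (weighted_lebesgue \<omega>) (ball a r) \<le>
    ennreal (2 powr q * M * measure lebesgue (ball a r) powr q) *
      (\<integral>\<^sup>+x\<in>ball a r. ennreal (F x) \<partial>weighted_lebesgue \<omega>)"
proof -
  let ?Q = "ball a r"
  define \<sigma> where "\<sigma> = (\<lambda>x. \<omega> x powr (1 / (1 - q)))"
  define X where "X = (\<integral>\<^sup>+x\<in>?Q. ennreal (F x) \<partial>weighted_lebesgue \<omega>)"
  define Y where "Y = (\<integral>\<^sup>+x\<in>?Q. ennreal (\<sigma> x) \<partial>lebesgue)"
  define V where "V = emeasure (weighted_lebesgue \<omega>) ?Q"
  define vol where "vol = measure lebesgue ?Q"
  have \<omega>: "weight \<omega>" using A by (simp add: muckenhoupt_def)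
  have \<omega>_meas [measurable]: "\<omega> \<in> borel_measurable lebesgue" by (rule weight_borel_measurable[OF \<omega>])
  have \<omega>_pos: "AE x in lebesgue. \<omega> x > 0" using \<omega> by (simp add: weight_def)
  note [measurable] = F
  have \<sigma>_meas [measurable]: "\<sigma> \<in> borel_measurable lebesgue" unfolding \<sigma>_def by measurable
  have Q_sets [measurable]: "?Q \<in> sets lebesgue" by simp
  have meas_ind: "(\<lambda>x. ennreal (G x) * indicator ?Q x) \<in> borel_measurable lebesgue"
    if "G \<in> borel_measurable lebesgue" for G
    using that by (intro borel_measurable_times_ennreal borel_measurable_indicator Q_sets) measurable
  have F\<omega>_meas: "(\<lambda>x. F x * \<omega> x) \<in> borel_measurable lebesgue" by measurable
  have V_eq: "V = (\<integral>\<^sup>+x\<in>?Q. ennreal (\<omega> x) \<partial>lebesgue)"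
    unfolding V_def weighted_lebesgue_def by (subst emeasure_density) auto
  have X_eq: "X = (\<integral>\<^sup>+x. ennreal (F x * \<omega> x) * indicator ?Q x \<partial>lebesgue)"
  proof -
    have "X = (\<integral>\<^sup>+x. ennreal (\<omega> x) * (ennreal (F x) * indicator ?Q x) \<partial>lebesgue)"
      unfolding X_def
      by (rule nn_integral_weighted_lebesgue[OF \<omega>])
         (rule meas_ind[OF F])
    also have "\<dots> = (\<integral>\<^sup>+x. ennreal (F x * \<omega> x) * indicator ?Q x \<partial>lebesgue)"
      using F_nonneg by (intro nn_integral_cong) (simp add: ennreal_mult' mult_ac)
    finally show ?thesis .
  qed
  have V_pos: "V \<noteq> 0" unfolding V_eq
    by (rule nn_integral_AE_pos_ball[OF _ _ r]) (use \<omega>_pos in \<open>auto simp: ennreal_less_zero_iff\<close>)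
  have V_fin: "V \<noteq> \<infinity>" using emeasure_weighted_ball_finite[OF \<omega>, of a r] by (simp add: V_def)
  have Y_pos: "Y \<noteq> 0" unfolding Y_def
  proof (rule nn_integral_AE_pos_ball[OF _ _ r])
    show "AE x in lebesgue. 0 < ennreal (\<sigma> x)"
      using \<omega>_pos by eventually_elim (simp add: \<sigma>_def)
  qed measurable
  have vol: "emeasure lebesgue ?Q = ennreal vol" "vol > 0"
    using r content_ball_pos[OF r, of a] by (auto simp: vol_def emeasure_eq_measure2 emeasure_lborel_ball_finite)
  have Aq: "V \<le> ennreal M * ennreal_rpow (ennreal vol) q * ennreal_rpow Y (1 - q)"
    using A r unfolding muckenhoupt_def cube_or_ball_def V_eq Y_def \<sigma>_def vol(1)[symmetric] by blast
  \<comment> \<open>If \<open>Y\<close> were infinite, its negative power would vanish, which would force \<open>V = 0\<close>.\<close>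
  have Y_fin: "Y \<noteq> \<infinity>"
    using Aq V_pos q by (auto simp: ennreal_rpow_def)
  obtain y where y: "Y = ennreal y" "y > 0"
    using Y_fin Y_pos by (cases Y) (auto simp: order.strict_iff_order)
  obtain w where w: "V = ennreal w" "w > 0"
    using V_fin V_pos by (cases V) (auto simp: order.strict_iff_order)
  have w_le: "w \<le> M * vol powr q * y powr (1 - q)"
  proof -
    have "ennreal w \<le> ennreal (M * vol powr q * y powr (1 - q))"
      using Aq q vol y w M by (auto simp: ennreal_rpow_def ennreal_mult)
    then show ?thesis using M by (subst (asm) ennreal_le_iff) auto
  qed
  have coeff_pos: "2 powr q * M * vol powr q > 0" using M vol by simp
  have "ennreal (m powr q) * V \<le> ennreal (2 powr q * M * vol powr q) * X"
  proof (cases X)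
    case top
    then show ?thesis using M vol by (simp add: ennreal_mult_top)
  next
    case (real x)
    show ?thesis
    proof (cases "x = 0")
      case True
      have "AE z in lebesgue. ennreal (F z * \<omega> z) * indicator ?Q z = 0"
        using real True unfolding X_eq
        by (subst nn_integral_0_iff_AE[OF meas_ind[OF F\<omega>_meas], symmetric]) simp
      then have "AE z in lebesgue. ennreal (F z powr (1 / q)) * indicator ?Q z = 0"
        using \<omega>_pos
      proof eventually_elim
        case (elim z)
        then show ?case using F_nonneg[of z]
          by (auto simp: indicator_def ennreal_eq_0_iff mult_le_0_iff split: if_splits)
      qed
      then have "(\<integral>\<^sup>+z\<in>?Q. ennreal (F z powr (1 / q)) \<partial>lebesgue) = 0"
        by (subst nn_integral_0_iff_AE[OF meas_ind]) measurable
      then have "m = 0" using m by simp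
      then show ?thesis by simp
    next
      case False
      then have x: "X = ennreal x" "x > 0" using real by auto
      define k where "k = x powr (1 / q) * y powr (1 - 1 / q)"
      have k: "k > 0" using x y by (simp add: k_def)
      have young: "F z powr (1 / q) \<le> k / x * (F z * \<omega> z) + k / y * \<sigma> z" if "\<omega> z > 0" for z
      proof (cases "F z = 0")
        case True
        then show ?thesis using k y by (simp add: \<sigma>_def)
      next
        case Fz: False
        then have Fz: "F z > 0" using F_nonneg[of z] by simp
        define A B where "A = F z * \<omega> z / x" and "B = \<sigma> z / y"
        have AB: "A > 0" "B > 0" using Fz that x y by (auto simp: A_def B_def \<sigma>_def)
        have "A powr (1 / q) * B powr (1 - 1 / q) \<le> 1 / q * A + (1 - 1 / q) * B"
          using q AB by (intro Youngs_inequality_0) auto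
        also have "\<dots> \<le> 1 * A + 1 * B"
          using q AB by (intro add_mono mult_right_mono) auto
        finally have AB_le: "A powr (1 / q) * B powr (1 - 1 / q) \<le> A + B" by simp
        have "\<sigma> z powr (1 - 1 / q) = \<omega> z powr (- 1 / q)"
        proof -
          have "1 / (1 - q) * (1 - 1 / q) = - 1 / q" using q by (simp add: field_simps)
          then show ?thesis unfolding \<sigma>_def by (simp only: powr_powr)
        qed
        then have "k * (A powr (1 / q) * B powr (1 - 1 / q)) = F z powr (1 / q) * (\<omega> z powr (1 / q) * \<omega> z powr (- 1 / q))"
          using Fz that x y by (simp add: A_def B_def k_def powr_mult powr_divide \<sigma>_def)
        also have "\<dots> = F z powr (1 / q)"
          using that by (simp flip: powr_add)
        finally have "F z powr (1 / q) = k * (A powr (1 / q) * B powr (1 - 1 / q))" by simp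
        also have "\<dots> \<le> k * (A + B)" using AB_le k by (intro mult_left_mono) auto
        finally show ?thesis by (simp add: A_def B_def algebra_simps)
      qed
      have "ennreal m \<le> (\<integral>\<^sup>+z. ennreal (F z powr (1 / q)) * indicator ?Q z \<partial>lebesgue)" by (rule m)
      also have "\<dots> \<le> (\<integral>\<^sup>+z. ennreal (k / x) * (ennreal (F z * \<omega> z) * indicator ?Q z) +
          ennreal (k / y) * (ennreal (\<sigma> z) * indicator ?Q z) \<partial>lebesgue)"
      proof (rule nn_integral_mono_AE)
        show "AE z in lebesgue. ennreal (F z powr (1 / q)) * indicator ?Q z \<le>
          ennreal (k / x) * (ennreal (F z * \<omega> z) * indicator ?Q z) +
          ennreal (k / y) * (ennreal (\<sigma> z) * indicator ?Q z)"
          using \<omega>_pos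
        proof eventually_elim
          case (elim z)
          have "ennreal (F z powr (1 / q)) \<le> ennreal (k / x) * ennreal (F z * \<omega> z) + ennreal (k / y) * ennreal (\<sigma> z)"
            using young[OF elim] k x y F_nonneg[of z] elim
            by (simp flip: ennreal_mult ennreal_plus add: ennreal_leI \<sigma>_def)
          then show ?case by (auto simp: indicator_def)
        qed
      qed
      also have "\<dots> = ennreal (k / x) * X + ennreal (k / y) * Y"
      proof -
        note 1 = meas_ind[OF F\<omega>_meas] and 2 = meas_ind[OF \<sigma>_meas]
        show ?thesis
          unfolding X_eq Y_def
          by (subst nn_integral_add)
             (simp_all only: nn_integral_cmult[OF 1] nn_integral_cmult[OF 2] borel_measurable_times_ennreal 1 2 borel_measurable_const)
      qed
      also have "\<dots> = ennreal (2 * k)"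
        using x y k by (simp flip: ennreal_mult ennreal_plus)
      finally have "m \<le> 2 * k" using k by (subst (asm) ennreal_le_iff) auto
      then have "m powr q \<le> (2 * k) powr q" using m q by (intro powr_mono2) auto
      also have "\<dots> = 2 powr q * (x * y powr (q - 1))"
      proof -
        have "(1 - 1 / q) * q = q - 1" using q by (simp add: field_simps)
        then show ?thesis using q x y k by (simp add: k_def powr_mult powr_powr)
      qed
      finally have "m powr q * w \<le> (2 powr q * (x * y powr (q - 1))) * (M * vol powr q * y powr (1 - q))"
        using w w_le x by (intro mult_mono) auto
      also have "\<dots> = 2 powr q * M * vol powr q * x * (y powr (q - 1) * y powr (1 - q))"
        by (simp only: mult_ac)
      also have "y powr (q - 1) * y powr (1 - q) = 1"
        using y by (simp flip: powr_add)
      finally show ?thesis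
        using x w coeff_pos by (simp add: ennreal_leI flip: ennreal_mult)
    qed
  qed
  then show ?thesis by (simp add: V_def X_def vol_def)
qed

text \<open>
  The preceding lemma for the indicator function of the smaller ball.
\<close>

lemma muckenhoupt_doubling:
  fixes a b :: "complex ^ 'n"
  assumes A: "muckenhoupt q M \<omega>" and q: "q > 1" and M: "M \<ge> 1" and s: "s > 0"
    and sub: "ball b s \<subseteq> ball a r"
  shows "emeasure (weighted_lebesgue \<omega>) (ball a r) \<le>
    ennreal (2 powr q * M * ((r / s) ^ DIM(complex ^ 'n)) powr q) *
      emeasure (weighted_lebesgue \<omega>) (ball b s)"
proof -
  let ?N = "DIM(complex ^ 'n)" and ?W = "weighted_lebesgue \<omega>"
  have "b \<in> ball a r" using subsetD[OF sub, of b] s by simp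
  then have r: "r > 0" using zero_le_dist[of a b] by (simp del: zero_le_dist)
  define v where "v = unit_ball_vol (real ?N)"
  have v: "v > 0" by (simp add: v_def)
  have ball_vol: "measure lebesgue (ball c t) = v * t ^ ?N" if "t > 0" for c :: "complex ^ 'n" and t
    using that content_ball[of t c] by (simp add: v_def)
  define m where "m = measure lebesgue (ball b s)"
  have m: "m > 0" using s v by (simp add: m_def ball_vol)
  have "ennreal (m powr q) * emeasure ?W (ball a r) \<le>
    ennreal (2 powr q * M * measure lebesgue (ball a r) powr q) *
      (\<integral>\<^sup>+x\<in>ball a r. ennreal (indicator (ball b s) x) \<partial>?W)"
  proof (rule muckenhoupt_holder[OF A q M r])
    show "indicat_real (ball b s) \<in> borel_measurable lebesgue" by (intro borel_measurable_indicator) simp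
    have "(\<integral>\<^sup>+x\<in>ball a r. ennreal (indicator (ball b s) x powr (1 / q)) \<partial>lebesgue)
        = (\<integral>\<^sup>+x. indicator (ball b s) x \<partial>lebesgue)"
      using sub q by (intro nn_integral_cong) (auto simp: indicator_def)
    also have "\<dots> = ennreal m"
      by (simp add: m_def emeasure_eq_measure2 emeasure_lborel_ball_finite)
    finally show "ennreal m \<le> (\<integral>\<^sup>+x\<in>ball a r. ennreal (indicator (ball b s) x powr (1 / q)) \<partial>lebesgue)"
      by simp
  qed (use m in auto)
  also have "(\<integral>\<^sup>+x\<in>ball a r. ennreal (indicator (ball b s) x) \<partial>?W) = (\<integral>\<^sup>+x. indicator (ball b s) x \<partial>?W)"
    using sub by (intro nn_integral_cong) (auto simp: indicator_def)
  also have "\<dots> = emeasure ?W (ball b s)" by simp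
  finally have le: "ennreal (m powr q) * emeasure ?W (ball a r) \<le>
    ennreal (2 powr q * M * measure lebesgue (ball a r) powr q) * emeasure ?W (ball b s)" .
  have "measure lebesgue (ball a r) = (r / s) ^ ?N * m"
  proof -
    have e: "measure lebesgue (ball a r) = v * r ^ ?N" "m = v * s ^ ?N"
      unfolding m_def by (rule ball_vol[OF r], rule ball_vol[OF s])
    show ?thesis unfolding e using s by (simp add: power_divide)
  qed
  then have "2 powr q * M * measure lebesgue (ball a r) powr q =
      m powr q * (2 powr q * M * ((r / s) ^ ?N) powr q)"
    using r s m by (simp only: powr_mult mult_ac)
  then have "ennreal (m powr q) * emeasure ?W (ball a r) \<le>
    ennreal (m powr q) * (ennreal (2 powr q * M * ((r / s) ^ ?N) powr q) * emeasure ?W (ball b s))"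
    using le M by (simp add: ennreal_mult mult_ac)
  then show ?thesis
    using m by (subst (asm) ennreal_mult_le_mult_iff) auto
qed

section \<open>The weighted local estimate\<close>

text \<open>
  With \<open>s = p/q\<close> and \<open>F = \<bar>f\<bar>\<^sup>p\<close> on the ball of radius \<open>R = d/2\<close> (and \<open>0\<close> elsewhere), \<open>F\<^sup>1\<^sup>/\<^sup>q = \<bar>f\<bar>\<^sup>s\<close> is the
  function whose integral controls \<open>\<bar>f\<bar>\<close>, hence the oscillation of \<open>h\<close>. The Muckenhoupt condition is
  applied directly on the large ball of radius \<open>C\<^sub>1 d\<close>, which need not lie where \<open>h\<close> and \<open>g\<close> are
  holomorphic: the weight lives on the whole space, and so does \<open>F\<close>.
\<close>

lemma weighted_oscillation_bound:
  fixes p q M C1 :: real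
  assumes p: "p > 0" and q: "q > 1" and M: "M \<ge> 1" and C1: "C1 \<ge> 1"
  obtains K where "K > 0"
    "\<And>\<omega> h g (x :: complex ^ 'n) d. muckenhoupt q M \<omega> \<Longrightarrow>
      holomorphic_on_cn h (ball x d) \<Longrightarrow> holomorphic_on_cn g (ball x d) \<Longrightarrow> d > 0 \<Longrightarrow>
      \<exists>a\<ge>0. (\<forall>y\<in>ball x (d / 8). norm (h y - h x) \<le> a) \<and>
        ennreal (a powr p) * emeasure (weighted_lebesgue \<omega>) (ball x (C1 * d)) \<le>
          ennreal K * (\<integral>\<^sup>+z\<in>cball x (d / 2). ennreal (norm (h z + cnj (g z)) powr p) \<partial>weighted_lebesgue \<omega>)"
proof -
  define N where "N = DIM(complex ^ 'n)"
  define v where "v = unit_ball_vol (real N)"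
  have v: "v > 0" by (simp add: v_def)
  define s where "s = p / q"
  have s: "s > 0" using p q by (simp add: s_def)
  obtain c where c: "c > 0"
    "\<And>h g (x :: complex ^ 'n) R y. holomorphic_on_cn h (cball x R) \<Longrightarrow> holomorphic_on_cn g (cball x R) \<Longrightarrow>
      R > 0 \<Longrightarrow> y \<in> cball x (R / 2) \<Longrightarrow>
      ennreal (c * R ^ N * norm (h y + cnj (g y)) powr s) \<le>
        (\<integral>\<^sup>+z\<in>cball x R. ennreal (norm (h z + cnj (g z)) powr s) \<partial>lborel)"
    using pluriharmonic_power_sub_mean_value[OF s, where 'n='n] unfolding N_def by blast
  define K where "K = 4 powr p * (2 powr q * M * (v * (2 * C1) ^ N / c) powr q)"
  have Kpos: "K > 0" using M v C1 c by (simp add: K_def)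
  show ?thesis
  proof (rule that[OF Kpos])
    fix \<omega> :: "complex ^ 'n \<Rightarrow> real" and h g and x :: "complex ^ 'n" and d :: real
    assume A: "muckenhoupt q M \<omega>" and h: "holomorphic_on_cn h (ball x d)"
      and g: "holomorphic_on_cn g (ball x d)" and d: "d > 0"
    define f where "f = (\<lambda>z. h z + cnj (g z))"
    define R where "R = d / 2"
    have R: "R > 0" using d by (simp add: R_def)
    have sub: "cball x R \<subseteq> ball x d" using d by (auto simp: R_def)
    have f_cont: "continuous_on (cball x R) f"
      unfolding f_def
      by (intro continuous_intros holomorphic_on_cn_imp_continuous_on holomorphic_on_cn_subset[OF _ sub] h g)
    define i where "i = (\<integral>\<^sup>+z\<in>cball x R. ennreal (norm (f z) powr s) \<partial>lborel)"
    have "i \<noteq> \<infinity>"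
    proof -
      have "compact ((\<lambda>z. norm (f z) powr s) ` cball x R)"
        using s by (intro compact_continuous_image compact_cball continuous_on_powr' continuous_intros f_cont) auto
      then obtain b where "\<forall>z\<in>cball x R. norm (norm (f z) powr s) \<le> b"
        by (metis (no_types, lifting) bounded_iff compact_imp_bounded imageI)
      then have "i \<le> (\<integral>\<^sup>+z. ennreal b * indicator (cball x R) z \<partial>lborel)"
        unfolding i_def by (intro nn_integral_mono) (auto simp: indicator_def intro!: ennreal_leI)
      also have "\<dots> = ennreal b * emeasure lborel (cball x R)"
        by (subst nn_integral_cmult_indicator) auto
      also have "\<dots> < \<infinity>" using emeasure_lborel_cball_finite[of x R] by (simp add: ennreal_mult_less_top)
      finally show ?thesis by simp
    qed
    then obtain j where j: "i = ennreal j" "j \<ge> 0" by (cases i) auto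
    define a where "a = 4 * (j / (c * R ^ N)) powr (1 / s)"
    have "norm (f z) \<le> (j / (c * R ^ N)) powr (1 / s)" if z: "z \<in> ball x (R / 2)" for z
    proof -
      have "ennreal (c * R ^ N * norm (f z) powr s) \<le> ennreal j"
        unfolding j(1)[symmetric] i_def f_def
        by (rule c(2)) (use z R in \<open>auto intro: holomorphic_on_cn_subset[OF h sub] holomorphic_on_cn_subset[OF g sub]\<close>)
      then have "norm (f z) powr s \<le> j / (c * R ^ N)"
        using j c R by (subst (asm) ennreal_le_iff) (auto simp: field_simps)
      then have "(norm (f z) powr s) powr (1 / s) \<le> (j / (c * R ^ N)) powr (1 / s)"
        using s by (intro powr_mono2) auto
      then show ?thesis using s by (simp add: powr_powr)
    qed
    then have osc: "norm (h y - h x) \<le> a" if "y \<in> ball x (d / 8)" for y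
      unfolding a_def
      by (intro holomorphic_part_oscillation[of h x "R / 2" g])
         (use that sub R in \<open>auto simp: R_def f_def intro!: holomorphic_on_cn_subset[OF h] holomorphic_on_cn_subset[OF g]\<close>)
    define F where "F = (\<lambda>z. indicator (cball x R) z *\<^sub>R (norm (f z) powr p))"
    have "F \<in> borel_measurable borel"
      unfolding F_def using p
      by (intro borel_measurable_continuous_on_indicator continuous_on_powr' continuous_intros f_cont) auto
    then have F_meas: "F \<in> borel_measurable lebesgue" by (simp add: measurable_completion)
    have Rd: "R < C1 * d" using C1 d mult_right_mono[of 1 C1 d] by (simp add: R_def)
    have QR: "cball x R \<subseteq> ball x (C1 * d)" using Rd by auto
    define I where "I = (\<integral>\<^sup>+z\<in>cball x R. ennreal (norm (f z) powr p) \<partial>weighted_lebesgue \<omega>)"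
    have "ennreal (j powr q) * emeasure (weighted_lebesgue \<omega>) (ball x (C1 * d)) \<le>
      ennreal (2 powr q * M * measure lebesgue (ball x (C1 * d)) powr q) *
        (\<integral>\<^sup>+z\<in>ball x (C1 * d). ennreal (F z) \<partial>weighted_lebesgue \<omega>)"
    proof (rule muckenhoupt_holder[OF A q M _ F_meas])
      show "0 < C1 * d" using Rd R by simp
      show "0 \<le> F z" for z by (simp add: F_def)
      have "ennreal j = (\<integral>\<^sup>+z\<in>cball x R. ennreal (norm (f z) powr s) \<partial>lebesgue)"
        by (simp add: j(1)[symmetric] i_def nn_integral_completion)
      also have "\<dots> = (\<integral>\<^sup>+z\<in>ball x (C1 * d). ennreal (F z powr (1 / q)) \<partial>lebesgue)"
        using QR q by (intro nn_integral_cong) (auto simp: indicator_def F_def powr_powr s_def)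
      finally show "ennreal j \<le> (\<integral>\<^sup>+z\<in>ball x (C1 * d). ennreal (F z powr (1 / q)) \<partial>lebesgue)" by simp
    qed (rule j)
    also have "(\<integral>\<^sup>+z\<in>ball x (C1 * d). ennreal (F z) \<partial>weighted_lebesgue \<omega>) = I"
      unfolding I_def using QR by (intro nn_integral_cong) (auto simp: indicator_def F_def)
    also have "measure lebesgue (ball x (C1 * d)) = v * (C1 * d) ^ N"
      using content_ball[of "C1 * d" x] Rd R by (simp add: v_def N_def)
    finally have main: "ennreal (j powr q) * emeasure (weighted_lebesgue \<omega>) (ball x (C1 * d)) \<le>
      ennreal (2 powr q * M * (v * (C1 * d) ^ N) powr q) * I" .
    define k where "k = 4 powr p / (c * R ^ N) powr q"
    have k: "k \<ge> 0" by (simp add: k_def)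
    have a_powr: "a powr p = k * j powr q"
    proof -
      have "1 / s * p = q" using p q by (simp add: s_def)
      then have "a powr p = 4 powr p * (j / (c * R ^ N)) powr q"
        using j c R by (simp only: a_def powr_mult powr_powr)
      then show ?thesis using j c R by (simp add: k_def powr_divide)
    qed
    have K_eq: "k * (2 powr q * M * (v * (C1 * d) ^ N) powr q) = K"
    proof -
      have "v * (C1 * d) ^ N / (c * R ^ N) = v * (2 * C1) ^ N / c"
        using d c by (simp add: R_def power_mult_distrib power_divide field_simps)
      then have "(v * (C1 * d) ^ N) powr q / (c * R ^ N) powr q = (v * (2 * C1) ^ N / c) powr q"
        using v c R Rd by (subst powr_divide[symmetric]) auto
      moreover have "k * (2 powr q * M * (v * (C1 * d) ^ N) powr q) =
          4 powr p * (2 powr q * M * ((v * (C1 * d) ^ N) powr q / (c * R ^ N) powr q))"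
        by (simp add: k_def)
      ultimately show ?thesis by (simp only: K_def)
    qed
    have "ennreal (a powr p) * emeasure (weighted_lebesgue \<omega>) (ball x (C1 * d)) =
        ennreal k * (ennreal (j powr q) * emeasure (weighted_lebesgue \<omega>) (ball x (C1 * d)))"
      unfolding a_powr using k by (simp add: ennreal_mult mult.assoc)
    also have "\<dots> \<le> ennreal k * (ennreal (2 powr q * M * (v * (C1 * d) ^ N) powr q) * I)"
      by (intro mult_left_mono main) simp
    also have "\<dots> = ennreal K * I"
      unfolding K_eq[symmetric] using k M by (simp add: ennreal_mult mult.assoc)
    finally show "\<exists>a\<ge>0. (\<forall>y\<in>ball x (d / 8). norm (h y - h x) \<le> a) \<and>
        ennreal (a powr p) * emeasure (weighted_lebesgue \<omega>) (ball x (C1 * d)) \<le>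
          ennreal K * (\<integral>\<^sup>+z\<in>cball x (d / 2). ennreal (norm (h z + cnj (g z)) powr p) \<partial>weighted_lebesgue \<omega>)"
      using osc by (intro exI[of _ a]) (auto simp: a_def I_def R_def f_def)
  qed
qed

section \<open>Whitney balls in John domains\<close>

lemma frontier_distance_pos:
  fixes x :: "'a::euclidean_space"
  assumes "open \<Omega>" "\<Omega> \<noteq> UNIV" "x \<in> \<Omega>"
  shows "infdist x (frontier \<Omega>) > 0"
proof -
  have "frontier \<Omega> \<noteq> {}" using assms frontier_eq_empty by blast
  moreover have "x \<notin> frontier \<Omega>" using assms by (simp add: frontier_def interior_open)
  ultimately show ?thesis by (simp add: infdist_pos_not_in_closed)
qed

lemma ball_frontier_distance_subset:
  fixes x :: "'a::euclidean_space"
  assumes "x \<in> \<Omega>"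
  shows "ball x (infdist x (frontier \<Omega>)) \<subseteq> \<Omega>"
proof
  fix y assume y: "y \<in> ball x (infdist x (frontier \<Omega>))"
  show "y \<in> \<Omega>"
  proof (rule ccontr)
    assume "y \<notin> \<Omega>"
    then have "ball x (infdist x (frontier \<Omega>)) \<inter> frontier \<Omega> \<noteq> {}"
    proof (intro connected_Int_frontier connected_ball)
      have "infdist x (frontier \<Omega>) > 0" using y le_less_trans[OF zero_le_dist[of x y]] by (metis mem_ball)
      then have "x \<in> ball x (infdist x (frontier \<Omega>)) \<inter> \<Omega>" using assms by simp
      then show "ball x (infdist x (frontier \<Omega>)) \<inter> \<Omega> \<noteq> {}" by (metis empty_iff)
    qed (use y \<open>y \<notin> \<Omega>\<close> in auto)
    then obtain z where "z \<in> frontier \<Omega>" "dist x z < infdist x (frontier \<Omega>)"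
      by (auto simp: disjoint_iff)
    then show False using infdist_le[of z "frontier \<Omega>" x] by simp
  qed
qed

lemma frontier_distance_lipschitz:
  "infdist x (frontier \<Omega>) \<le> infdist y (frontier \<Omega>) + dist x y"
  using infdist_triangle[of x "frontier \<Omega>" y] by simp

lemma nn_integral_count_space_disjoint_indicator:
  assumes "pairwise (\<lambda>i j. disjnt (B i) (B j)) I"
  shows "(\<integral>\<^sup>+j. indicator (B j) y \<partial>count_space I) = indicator (\<Union>j\<in>I. B j) y"
proof (cases "\<exists>j\<in>I. y \<in> B j")
  case True
  then obtain i where i: "i \<in> I" "y \<in> B i" by blast
  have "(\<integral>\<^sup>+j. indicator (B j) y \<partial>count_space I) = (\<integral>\<^sup>+j. indicator {i} j \<partial>count_space I)"
  proof (rule nn_integral_cong)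
    fix j assume "j \<in> space (count_space I)"
    then show "(indicator (B j) y :: ennreal) = indicator {i} j"
      using assms i by (auto simp: indicator_def pairwise_def disjnt_iff)
  qed
  also have "\<dots> = emeasure (count_space I) {i}"
    using i by (intro nn_integral_indicator) auto
  also have "\<dots> = 1" using i by (subst emeasure_count_space) auto
  finally show ?thesis using i by (auto simp: indicator_def)
next
  case False
  then have "(\<integral>\<^sup>+j. indicator (B j) y \<partial>count_space I) = (\<integral>\<^sup>+j. 0 \<partial>count_space I)"
    by (intro nn_integral_cong) auto
  then show ?thesis using False by (auto simp: indicator_def)
qed

text \<open>
  A John domain with centre \<open>x\<^sub>0\<close> and a fixed Whitney family of centres \<open>I\<close>. The radius \<open>d(x)/8\<close> of the
  covering balls is five times the radius \<open>d(x)/40\<close> of the disjoint ones because it comes from Vitali's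
  covering lemma. It leaves room for the local estimate, which bounds oscillations on the ball of radius
  \<open>d(x)/8\<close> by integrals over the ball of radius \<open>d(x)/2\<close>.
\<close>

locale whitney_john =
  fixes \<delta> :: real and \<Omega> :: "(complex ^ 'n) set" and d :: "complex ^ 'n \<Rightarrow> real"
    and x0 :: "complex ^ 'n" and I :: "(complex ^ 'n) set"
  assumes open_\<Omega>: "open \<Omega>" and \<Omega>_proper: "\<Omega> \<noteq> UNIV" and \<delta>_pos: "\<delta> > 0" and x0: "x0 \<in> \<Omega>"
    and d_def: "d = (\<lambda>x. infdist x (frontier \<Omega>))"
    and john: "\<And>x. x \<in> \<Omega> \<Longrightarrow> \<exists>\<gamma>. path \<gamma> \<and> pathstart \<gamma> = x0 \<and> pathfinish \<gamma> = x \<and> path_image \<gamma> \<subseteq> \<Omega> \<and>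
      (\<forall>\<xi>\<in>path_image \<gamma>. \<delta> * dist \<xi> x \<le> d \<xi>)"
    and countable_I: "countable I" and I_subset: "I \<subseteq> \<Omega>"
    and disjoint_I: "pairwise (\<lambda>x y. disjnt (ball x (d x / 40)) (ball y (d y / 40))) I"
    and cover_I: "\<Omega> \<subseteq> (\<Union>x\<in>I. ball x (d x / 8))"
begin

lemma d_pos: "x \<in> \<Omega> \<Longrightarrow> d x > 0"
  using frontier_distance_pos[OF open_\<Omega> \<Omega>_proper] by (simp add: d_def)

lemma ball_d_subset: "x \<in> \<Omega> \<Longrightarrow> r \<le> d x \<Longrightarrow> ball x r \<subseteq> \<Omega>"
  using ball_frontier_distance_subset[of x \<Omega>] subset_ball[of r "d x" x] by (auto simp: d_def)

lemma d_lipschitz: "d x \<le> d y + dist x y"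
  using frontier_distance_lipschitz[of x \<Omega> y] by (simp add: d_def)

lemma domain_subset_ball: "\<Omega> \<subseteq> cball x0 (d x0 / \<delta>)"
proof
  fix x assume "x \<in> \<Omega>"
  then obtain \<gamma> where "pathstart \<gamma> = x0" "\<forall>\<xi>\<in>path_image \<gamma>. \<delta> * dist \<xi> x \<le> d \<xi>"
    using john by blast
  then have "\<delta> * dist x0 x \<le> d x0" using pathstart_in_path_image by blast
  then show "x \<in> cball x0 (d x0 / \<delta>)" using \<delta>_pos by (simp add: field_simps)
qed

text \<open>
  A point \<open>t\<close> of \<open>[0, u(x)]\<close> is a value of \<open>u\<close> at some \<open>\<xi>\<close> on the John curve, hence lies within
  \<open>osc j\<close> of \<open>u(j)\<close> for a Whitney ball containing \<open>\<xi>\<close>. So these intervals of length \<open>2 osc j\<close> cover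
  \<open>[0, u(x)]\<close>, and the estimate is countable subadditivity of length. The John condition enters only
  through the restriction to those \<open>j\<close> for which \<open>x\<close> is in the enlarged ball.
\<close>

lemma value_le_sum_of_oscillations:
  fixes u :: "complex ^ 'n \<Rightarrow> real" and osc :: "complex ^ 'n \<Rightarrow> real"
  assumes u: "continuous_on \<Omega> u" "u x0 = 0"
    and osc_nonneg: "\<And>j. j \<in> I \<Longrightarrow> 0 \<le> osc j"
    and osc: "\<And>j y. j \<in> I \<Longrightarrow> y \<in> ball j (d j / 8) \<Longrightarrow> \<bar>u y - u j\<bar> \<le> osc j"
    and x: "x \<in> \<Omega>"
  shows "ennreal (u x) \<le> (\<integral>\<^sup>+j. ennreal (2 * osc j) * indicator (ball j ((2 / \<delta> + 1) * d j)) x \<partial>count_space I)"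
proof (cases "u x \<ge> 0")
  case True
  obtain \<gamma> where \<gamma>: "path \<gamma>" "pathstart \<gamma> = x0" "pathfinish \<gamma> = x" "path_image \<gamma> \<subseteq> \<Omega>"
    and \<gamma>_john: "\<And>\<xi>. \<xi> \<in> path_image \<gamma> \<Longrightarrow> \<delta> * dist \<xi> x \<le> d \<xi>"
    using john[OF x] by blast
  define Z where "Z = (\<lambda>j. indicator (ball j ((2 / \<delta> + 1) * d j)) x :: ennreal)"
  have "connected (u ` path_image \<gamma>)"
    using \<gamma> by (intro connected_continuous_image connected_path_image continuous_on_subset[OF u(1)])
  moreover have "0 \<in> u ` path_image \<gamma>" "u x \<in> u ` path_image \<gamma>"
    using \<gamma> u(2) pathstart_in_path_image[of \<gamma>] pathfinish_in_path_image[of \<gamma>] by (auto intro: rev_image_eqI)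
  ultimately have interval: "{0..u x} \<subseteq> u ` path_image \<gamma>"
    by (rule connected_contains_Icc)
  have point: "(indicator {0..u x} t :: ennreal) \<le>
      (\<integral>\<^sup>+j. Z j * indicator {u j - osc j..u j + osc j} t \<partial>count_space I)" for t
  proof (cases "t \<in> {0..u x}")
    case True
    then obtain \<xi> where \<xi>: "\<xi> \<in> path_image \<gamma>" "t = u \<xi>" using interval by blast
    then obtain j where j: "j \<in> I" "\<xi> \<in> ball j (d j / 8)" using \<gamma>(4) cover_I by blast
    have "dist j x \<le> dist j \<xi> + dist \<xi> x" by (rule dist_triangle)
    \<comment> \<open>In fact \<open>\<delta> \<bar>\<xi> - x\<bar> \<le> d(\<xi>) \<le> 9/8 d(j)\<close>; the constant \<open>2\<close> is merely convenient.\<close>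
    moreover have "\<delta> * dist \<xi> x < 2 * d j"
      using \<gamma>_john[OF \<xi>(1)] d_lipschitz[of \<xi> j] j d_pos[of j] I_subset
      by (auto simp: dist_commute)
    then have "dist \<xi> x < 2 / \<delta> * d j" using \<delta>_pos by (simp add: field_simps)
    moreover have "dist j \<xi> \<le> d j" using j d_pos[of j] I_subset by auto
    ultimately have "dist j x < (2 / \<delta> + 1) * d j" by (simp add: distrib_right)
    then have "Z j = 1" by (simp add: Z_def)
    moreover have "\<bar>u \<xi> - u j\<bar> \<le> osc j" using osc[OF j] .
    ultimately have "1 = Z j * indicator {u j - osc j..u j + osc j} t"
      using \<xi> by (simp add: indicator_def abs_le_iff)
    also have "\<dots> \<le> (\<integral>\<^sup>+j. Z j * indicator {u j - osc j..u j + osc j} t \<partial>count_space I)"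
      by (rule nn_integral_ge_point[OF j(1)])
    finally show ?thesis using True by simp
  qed simp
  have "ennreal (u x) = (\<integral>\<^sup>+t. indicator {0..u x} t \<partial>lborel)"
    using True by simp
  also have "\<dots> \<le> (\<integral>\<^sup>+t. (\<integral>\<^sup>+j. Z j * indicator {u j - osc j..u j + osc j} t \<partial>count_space I) \<partial>lborel)"
    by (intro nn_integral_mono point)
  also have "\<dots> = (\<integral>\<^sup>+j. (\<integral>\<^sup>+t. Z j * indicator {u j - osc j..u j + osc j} t \<partial>lborel) \<partial>count_space I)"
    by (rule nn_integral_count_space_nn_integral[OF countable_I]) measurable
  also have "\<dots> = (\<integral>\<^sup>+j. ennreal (2 * osc j) * Z j \<partial>count_space I)"
    using osc_nonneg by (intro nn_integral_cong) (simp add: nn_integral_cmult_indicator mult.commute)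
  finally show ?thesis by (simp add: Z_def)
qed (simp add: ennreal_neg)

text \<open>
  If \<open>z\<close> is in the ball of radius \<open>d(j)/2\<close>, then \<open>2/3 d(z) \<le> d(j) \<le> 2 d(z)\<close>. So the disjoint small
  balls of all such \<open>j\<close> have radius at least \<open>d(z)/60\<close> and lie in the ball of radius \<open>2 d(z)\<close>
  about \<open>z\<close>; comparing volumes gives \<open>(2 \<cdot> 60)\<^sup>N\<close>.
\<close>

lemma whitney_overlap:
  assumes z: "z \<in> \<Omega>"
  shows "(\<integral>\<^sup>+j. indicator (cball j (d j / 2)) z \<partial>count_space I) \<le> ennreal (120 ^ DIM(complex ^ 'n))"
proof -
  define N where "N = DIM(complex ^ 'n)"
  define v where "v = unit_ball_vol (real N)"
  have v: "v > 0" by (simp add: v_def)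
  define D where "D = d z"
  have D: "D > 0" using d_pos[OF z] by (simp add: D_def)
  define B where "B = (\<lambda>j. ball j (d j / 40))"
  define c where "c = 1 / (v * (D / 60) ^ N)"
  have c: "c > 0" using v D by (simp add: c_def)
  have vol: "emeasure lborel (ball y r) = ennreal (v * r ^ N)" if "r \<ge> 0" for y :: "complex ^ 'n" and r
    using that by (simp add: emeasure_ball v_def N_def)
  have point: "indicator (cball j (d j / 2)) z \<le>
      (\<integral>\<^sup>+y. ennreal c * indicator (ball z (2 * D)) y * indicator (B j) y \<partial>lborel)" if j: "j \<in> I" for j
  proof (cases "z \<in> cball j (d j / 2)")
    case True
    then have zj: "dist j z \<le> d j / 2" by simp
    have dj: "d j \<le> 2 * D" "2 * D / 3 \<le> d j"
      using d_lipschitz[of j z] d_lipschitz[of z j] zj by (auto simp: D_def dist_commute)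
    have sub: "B j \<subseteq> ball z (2 * D)"
    proof
      fix y assume "y \<in> B j"
      then have "dist z y < d j / 2 + d j / 40"
        using dist_triangle[of z y j] zj by (simp add: B_def dist_commute)
      then show "y \<in> ball z (2 * D)" using dj D by simp
    qed
    have "1 = c * (v * (D / 60) ^ N)" using v D by (simp add: c_def)
    also have "\<dots> \<le> c * (v * (d j / 40) ^ N)"
      using c v D dj by (intro mult_left_mono power_mono) auto
    finally have "1 \<le> ennreal (c * (v * (d j / 40) ^ N))" by simp
    also have "\<dots> = ennreal c * emeasure lborel (B j)"
      using c dj D by (simp add: B_def vol ennreal_mult')
    also have "\<dots> = (\<integral>\<^sup>+y. ennreal c * indicator (B j) y \<partial>lborel)"
      by (subst nn_integral_cmult_indicator) (auto simp: B_def)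
    also have "\<dots> = (\<integral>\<^sup>+y. ennreal c * indicator (ball z (2 * D)) y * indicator (B j) y \<partial>lborel)"
      using sub by (intro nn_integral_cong) (auto simp: indicator_def)
    finally show ?thesis using True by simp
  qed simp
  have B_meas: "(\<lambda>y. ennreal c * indicator (ball z (2 * D)) y * indicator (B j) y) \<in> borel_measurable lborel" for j
    unfolding B_def
    by (intro borel_measurable_times_ennreal borel_measurable_const borel_measurable_indicator) simp_all
  have "(\<integral>\<^sup>+j. indicator (cball j (d j / 2)) z \<partial>count_space I) \<le>
      (\<integral>\<^sup>+j. (\<integral>\<^sup>+y. ennreal c * indicator (ball z (2 * D)) y * indicator (B j) y \<partial>lborel) \<partial>count_space I)"
    by (intro nn_integral_mono) (use point in auto)
  also have "\<dots> = (\<integral>\<^sup>+y. (\<integral>\<^sup>+j. ennreal c * indicator (ball z (2 * D)) y * indicator (B j) y \<partial>count_space I) \<partial>lborel)"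
    by (rule nn_integral_count_space_nn_integral[OF countable_I B_meas, symmetric])
  also have "\<dots> \<le> (\<integral>\<^sup>+y. ennreal c * indicator (ball z (2 * D)) y \<partial>lborel)"
  proof (intro nn_integral_mono)
    fix y
    have "(\<integral>\<^sup>+j. indicator (B j) y \<partial>count_space I) \<le> (1 :: ennreal)"
      using nn_integral_count_space_disjoint_indicator[of B I y] disjoint_I by (simp add: B_def indicator_def)
    from mult_left_mono[OF this, of "ennreal c * indicator (ball z (2 * D)) y"]
    show "(\<integral>\<^sup>+j. ennreal c * indicator (ball z (2 * D)) y * indicator (B j) y \<partial>count_space I) \<le>
      ennreal c * indicator (ball z (2 * D)) y"
      by (subst nn_integral_cmult) auto
  qed
  also have "\<dots> = ennreal (c * (v * (2 * D) ^ N))"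
    using c D v by (subst nn_integral_cmult_indicator) (auto simp: vol ennreal_mult)
  also have "c * (v * (2 * D) ^ N) = 120 ^ N"
  proof -
    have "(2 * D) ^ N = (120 * (D / 60)) ^ N" by simp
    then have "(2 * D) ^ N = 120 ^ N * (D / 60) ^ N" by (simp only: power_mult_distrib)
    then show ?thesis using v D by (simp add: c_def)
  qed
  finally show ?thesis by (simp add: N_def)
qed

end

lemma john_domain_whitney:
  assumes "john_domain \<delta> \<Omega>" and \<delta>: "\<delta> > 0"
  obtains x0 I where "whitney_john \<delta> \<Omega> (\<lambda>x. infdist x (frontier \<Omega>)) x0 I"
proof -
  let ?d = "\<lambda>x. infdist x (frontier \<Omega>)"
  from assms obtain x0 where op: "open \<Omega>" and proper: "\<Omega> \<noteq> UNIV" and x0: "x0 \<in> \<Omega>"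
    and john: "\<And>x. x \<in> \<Omega> \<Longrightarrow> \<exists>\<gamma>. path \<gamma> \<and> pathstart \<gamma> = x0 \<and> pathfinish \<gamma> = x \<and> path_image \<gamma> \<subseteq> \<Omega> \<and>
      (\<forall>\<xi>\<in>path_image \<gamma>. \<delta> * dist \<xi> x \<le> ?d \<xi>)"
    unfolding john_domain_def by blast
  have bound: "0 < ?d x / 40 \<and> ?d x / 40 \<le> ?d x0 + ?d x0 / \<delta>" if x: "x \<in> \<Omega>" for x
  proof -
    obtain \<gamma> where "pathstart \<gamma> = x0" "\<forall>\<xi>\<in>path_image \<gamma>. \<delta> * dist \<xi> x \<le> ?d \<xi>"
      using john[OF x] by blast
    then have "\<delta> * dist x0 x \<le> ?d x0" using pathstart_in_path_image by blast
    then have "dist x x0 \<le> ?d x0 / \<delta>" using \<delta> by (simp add: field_simps dist_commute)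
    then have "?d x \<le> ?d x0 + ?d x0 / \<delta>" using frontier_distance_lipschitz[of x \<Omega> x0] by linarith
    moreover have "?d x > 0" using frontier_distance_pos[OF op proper x] .
    ultimately show ?thesis by linarith
  qed
  obtain I where "countable I" "I \<subseteq> \<Omega>"
    "pairwise (\<lambda>x y. disjnt (ball x (?d x / 40)) (ball y (?d y / 40))) I"
    "\<Omega> \<subseteq> (\<Union>x\<in>I. ball x (5 * (?d x / 40)))"
  proof (rule Vitali_covering_lemma_balls[where S = \<Omega> and K = \<Omega> and a = "\<lambda>x. x" and r = "\<lambda>x. ?d x / 40"])
    show "\<Omega> \<subseteq> (\<Union>x\<in>\<Omega>. ball x (?d x / 40))" using bound by force
    show "0 < ?d x / 40 \<and> ?d x / 40 \<le> ?d x0 + ?d x0 / \<delta>" if "x \<in> \<Omega>" for x using bound[OF that] .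
  qed
  then have "whitney_john \<delta> \<Omega> ?d x0 I"
    using op proper \<delta> x0 john by unfold_locales auto
  then show ?thesis by (rule that)
qed

section \<open>A Poincare inequality on John domains\<close>

text \<open>
  By homogeneity, only the ratio \<open>s/t\<close> matters. If it is close to \<open>1\<close>, continuity of the power function
  suffices; otherwise \<open>\<bar>s - t\<bar>\<close> is comparable to the larger of \<open>s\<close> and \<open>t\<close>.
\<close>

lemma powr_diff_le:
  fixes p \<epsilon> :: real
  assumes p: "p > 0" and \<epsilon>: "\<epsilon> > 0"
  obtains C where "C > 0"
    "\<And>s t. 0 \<le> s \<Longrightarrow> 0 \<le> t \<Longrightarrow> \<bar>s powr p - t powr p\<bar> \<le> \<epsilon> * t powr p + C * \<bar>s - t\<bar> powr p"
proof -
  have "isCont (\<lambda>x :: real. x powr p) 1" by (intro continuous_intros) auto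
  then obtain \<eta> where \<eta>: "\<eta> > 0" "\<And>x. \<bar>x - 1\<bar> < \<eta> \<Longrightarrow> \<bar>x powr p - 1\<bar> < \<epsilon>"
    using \<epsilon> unfolding continuous_at_eps_delta by (auto simp: dist_real_def)
  define C where "C = (1 + 1 / \<eta>) powr p"
  have "1 + 1 / \<eta> > 0" using \<eta> by (simp add: add_pos_pos)
  then have C: "C > 0" by (simp add: C_def)
  show ?thesis
  proof (rule that[OF C])
    fix s t :: real assume st: "0 \<le> s" "0 \<le> t"
    show "\<bar>s powr p - t powr p\<bar> \<le> \<epsilon> * t powr p + C * \<bar>s - t\<bar> powr p"
    proof (cases "\<bar>s - t\<bar> < \<eta> * t")
      case True
      then have t: "t > 0" using \<eta> st by (cases "t = 0") auto
      then have "s / t - 1 = (s - t) / t" by (simp add: field_simps)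
      then have "\<bar>s / t - 1\<bar> < \<eta>" using True t by (simp add: field_simps)
      then have "\<bar>(s / t) powr p - 1\<bar> \<le> \<epsilon>" using \<eta>(2) by fastforce
      then have "\<bar>(s / t) powr p - 1\<bar> * t powr p \<le> \<epsilon> * t powr p" by (intro mult_right_mono) auto
      also have "\<bar>(s / t) powr p - 1\<bar> * t powr p = \<bar>((s / t) powr p - 1) * t powr p\<bar>"
        by (simp add: abs_mult)
      also have "((s / t) powr p - 1) * t powr p = s powr p - t powr p"
        using st t by (simp add: powr_divide left_diff_distrib)
      finally show ?thesis using C by (simp add: add_increasing2)
    next
      case False
      then have t_le: "t \<le> 1 / \<eta> * \<bar>s - t\<bar>" using \<eta> by (simp add: field_simps)
      have le: "t \<le> (1 + 1 / \<eta>) * \<bar>s - t\<bar>" "s \<le> (1 + 1 / \<eta>) * \<bar>s - t\<bar>"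
        using t_le by (simp_all add: distrib_right del: times_divide_eq_left)
      have "r powr p \<le> C * \<bar>s - t\<bar> powr p" if "0 \<le> r" "r \<le> (1 + 1 / \<eta>) * \<bar>s - t\<bar>" for r
      proof -
        have "r powr p \<le> ((1 + 1 / \<eta>) * \<bar>s - t\<bar>) powr p"
          using that p by (intro powr_mono2) auto
        also have "\<dots> = C * \<bar>s - t\<bar> powr p" using \<eta> by (simp add: C_def powr_mult)
        finally show ?thesis .
      qed
      from this[OF st(1) le(2)] this[OF st(2) le(1)]
      have "\<bar>s powr p - t powr p\<bar> \<le> C * \<bar>s - t\<bar> powr p"
        using powr_ge_zero[of s p] powr_ge_zero[of t p] by linarith
      then show ?thesis using \<epsilon> by (simp add: add_increasing)
    qed
  qed
qed

lemma borel_measurable_continuous_indicator_ennreal: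
  fixes u :: "'a::euclidean_space \<Rightarrow> real"
  assumes "continuous_on A u" "A \<in> sets borel"
  shows "(\<lambda>x. ennreal (u x) * indicator A x) \<in> borel_measurable lebesgue"
proof -
  have "(\<lambda>x. indicator A x *\<^sub>R u x) \<in> borel_measurable borel"
    using assms by (intro borel_measurable_continuous_on_indicator) auto
  then have "(\<lambda>x. ennreal (indicator A x *\<^sub>R u x)) \<in> borel_measurable borel" by measurable
  also have "(\<lambda>x. ennreal (indicator A x *\<^sub>R u x)) = (\<lambda>x. ennreal (u x) * indicator A x)"
    by (auto simp: fun_eq_iff indicator_def)
  finally show ?thesis by (simp add: measurable_completion)
qed

context whitney_john
begin

text \<open>
  The pointwise bound for \<open>u = G\<^sup>p\<close> is integrated against \<open>W\<close>. By doubling, \<open>osc j\<close> times the measure of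
  the enlarged ball is at most \<open>D\<close> times the integral of the constant \<open>osc j\<close> over the small ball
  \<open>B j\<close>, and on \<open>B j\<close> this constant is bounded by \<open>u / (4D)\<close> plus a multiple of \<open>(a j)\<^sup>p\<close>. Since the
  balls \<open>B j\<close> are disjoint, the first terms add up to at most half of the left-hand side. The upper
  bound \<open>T\<close> makes the left-hand side finite, as absorption requires; the constant is independent of
  \<open>T\<close>, so that \<open>T\<close> may tend to infinity afterwards.
\<close>

lemma john_poincare:
  fixes W :: "(complex ^ 'n) measure" and G a :: "complex ^ 'n \<Rightarrow> real"
  assumes W [measurable_cong]: "sets W = sets lebesgue" and W_fin: "emeasure W \<Omega> < \<infinity>"
    and p: "p > 0"
    and G: "continuous_on \<Omega> G" "G x0 = 0" and G_bounds: "\<And>x. x \<in> \<Omega> \<Longrightarrow> 0 \<le> G x \<and> G x \<le> T"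
    and osc_G: "\<And>j y z. j \<in> I \<Longrightarrow> y \<in> ball j (d j / 8) \<Longrightarrow> z \<in> ball j (d j / 8) \<Longrightarrow> \<bar>G y - G z\<bar> \<le> a j"
    and D: "D > 0"
    and doubling: "\<And>j. j \<in> I \<Longrightarrow> emeasure W (ball j ((2 / \<delta> + 1) * d j)) \<le> ennreal D * emeasure W (ball j (d j / 40))"
    and C: "C > 0" "\<And>s t. 0 \<le> s \<Longrightarrow> 0 \<le> t \<Longrightarrow>
      \<bar>s powr p - t powr p\<bar> \<le> 1 / (8 * D) * t powr p + C * \<bar>s - t\<bar> powr p"
  shows "(\<integral>\<^sup>+x\<in>\<Omega>. ennreal (G x powr p) \<partial>W) \<le>
    ennreal (8 * D * C) * (\<integral>\<^sup>+j. ennreal (a j powr p) * emeasure W (ball j (d j / 40)) \<partial>count_space I)"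
proof -
  define u where "u = (\<lambda>x. G x powr p)"
  define X where "X = (\<integral>\<^sup>+x\<in>\<Omega>. ennreal (u x) \<partial>W)"
  define B where "B = (\<lambda>j. ball j (d j / 40))"
  \<comment> \<open>The oscillation is taken over the covering ball, but bounded at each point of the disjoint ball.\<close>
  define osc where "osc = (\<lambda>j. SUP y\<in>ball j (d j / 8). \<bar>u y - u j\<bar>)"
  have u_bounds: "0 \<le> u x" "u x \<le> T powr p" if "x \<in> \<Omega>" for x
    using G_bounds[OF that] p by (auto simp: u_def intro: powr_mono2)
  have u_cont: "continuous_on \<Omega> u"
    unfolding u_def using p G_bounds by (intro continuous_on_powr' G continuous_intros) auto
  have u_x0: "u x0 = 0" using G p by (simp add: u_def)
  have j_facts: "d j > 0" "ball j (d j / 8) \<subseteq> \<Omega>" "B j \<subseteq> \<Omega>" "j \<in> ball j (d j / 8)" "B j \<subseteq> ball j (d j / 8)"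
    if "j \<in> I" for j
  proof -
    have j: "j \<in> \<Omega>" using that I_subset by auto
    show "d j > 0" using d_pos[OF j] .
    then show "ball j (d j / 8) \<subseteq> \<Omega>" "B j \<subseteq> \<Omega>" "j \<in> ball j (d j / 8)" "B j \<subseteq> ball j (d j / 8)"
      using ball_d_subset[OF j] by (auto simp: B_def)
  qed
  have u_osc: "\<bar>u y - u z\<bar> \<le> 1 / (8 * D) * u z + C * a j powr p"
    if j: "j \<in> I" and y: "y \<in> ball j (d j / 8)" and z: "z \<in> ball j (d j / 8)" for j y z
  proof -
    have "\<bar>u y - u z\<bar> \<le> 1 / (8 * D) * u z + C * \<bar>G y - G z\<bar> powr p"
      unfolding u_def using j_facts(2)[OF j] y z G_bounds by (intro C(2)) auto
    moreover have "C * \<bar>G y - G z\<bar> powr p \<le> C * a j powr p"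
      using osc_G[OF j y z] p C(1) by (intro mult_left_mono powr_mono2) auto
    ultimately show ?thesis by linarith
  qed
  have bdd: "bdd_above ((\<lambda>y. \<bar>u y - u j\<bar>) ` ball j (d j / 8))" if j: "j \<in> I" for j
    using u_osc[OF j _ j_facts(4)[OF j]] by (intro bdd_aboveI2) blast
  have osc_upper: "\<bar>u y - u j\<bar> \<le> osc j" if "j \<in> I" "y \<in> ball j (d j / 8)" for j y
    unfolding osc_def using that by (intro cSUP_upper bdd)
  have osc_nonneg: "0 \<le> osc j" if "j \<in> I" for j
    using osc_upper[OF that j_facts(4)[OF that]] by simp
  have osc_le: "osc j \<le> 2 * (1 / (8 * D) * u z + C * a j powr p)" if j: "j \<in> I" and z: "z \<in> B j" for j z
    unfolding osc_def
  proof (rule cSUP_least)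
    show "ball j (d j / 8) \<noteq> {}" using j_facts(4)[OF j] by blast
    fix y assume y: "y \<in> ball j (d j / 8)"
    have z': "z \<in> ball j (d j / 8)" using z j_facts(5)[OF j] by blast
    show "\<bar>u y - u j\<bar> \<le> 2 * (1 / (8 * D) * u z + C * a j powr p)"
    proof -
      have two: "\<bar>b - b'\<bar> \<le> 2 * e" if "\<bar>b - c\<bar> \<le> e" "\<bar>b' - c\<bar> \<le> e" for b b' c e :: real
        using that by linarith
      show ?thesis by (rule two[OF u_osc[OF j y z'] u_osc[OF j j_facts(4)[OF j] z']])
    qed
  qed
  have B_sets [measurable]: "B j \<in> sets W" for j by (simp add: B_def W)
  have u_meas: "(\<lambda>x. ennreal (u x) * indicator \<Omega> x) \<in> borel_measurable W"
    using borel_measurable_continuous_indicator_ennreal[OF u_cont] open_\<Omega>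
    by (simp cong: measurable_cong_sets add: W)
  have X_fin: "X \<noteq> \<infinity>"
  proof -
    have "X \<le> (\<integral>\<^sup>+x. ennreal (T powr p) * indicator \<Omega> x \<partial>W)"
      unfolding X_def using u_bounds by (intro nn_integral_mono) (auto simp: indicator_def intro!: ennreal_leI)
    also have "\<dots> = ennreal (T powr p) * emeasure W \<Omega>"
      using open_\<Omega> by (intro nn_integral_cmult_indicator) (simp add: W)
    also have "\<dots> < \<infinity>" using W_fin by (simp add: ennreal_mult_less_top)
    finally show ?thesis by simp
  qed
  define S where "S = (\<integral>\<^sup>+j. ennreal (a j powr p) * emeasure W (B j) \<partial>count_space I)"
  have Q_sets: "ball j ((2 / \<delta> + 1) * d j) \<in> sets W" for j by (simp add: W)
  have "X \<le> (\<integral>\<^sup>+x. (\<integral>\<^sup>+j. ennreal (2 * osc j) * indicator (ball j ((2 / \<delta> + 1) * d j)) x \<partial>count_space I) \<partial>W)"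
    unfolding X_def
  proof (rule nn_integral_mono)
    fix x
    show "ennreal (u x) * indicator \<Omega> x \<le>
        (\<integral>\<^sup>+j. ennreal (2 * osc j) * indicator (ball j ((2 / \<delta> + 1) * d j)) x \<partial>count_space I)"
      using value_le_sum_of_oscillations[OF u_cont u_x0 osc_nonneg osc_upper]
      by (cases "x \<in> \<Omega>") simp_all
  qed
  also have "\<dots> = (\<integral>\<^sup>+j. (\<integral>\<^sup>+x. ennreal (2 * osc j) * indicator (ball j ((2 / \<delta> + 1) * d j)) x \<partial>W) \<partial>count_space I)"
    using Q_sets by (intro nn_integral_count_space_nn_integral[OF countable_I]
        borel_measurable_times_ennreal borel_measurable_const borel_measurable_indicator)
  also have "\<dots> = (\<integral>\<^sup>+j. ennreal (2 * osc j) * emeasure W (ball j ((2 / \<delta> + 1) * d j)) \<partial>count_space I)"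
    using Q_sets by (intro nn_integral_cong nn_integral_cmult_indicator)
  also have "\<dots> \<le> (\<integral>\<^sup>+j. (\<integral>\<^sup>+z. ennreal (1 / 2) * (ennreal (u z) * indicator \<Omega> z) * indicator (B j) z +
      ennreal (4 * D * C) * (ennreal (a j powr p) * indicator (B j) z) \<partial>W) \<partial>count_space I)"
  proof (intro nn_integral_mono)
    fix j assume "j \<in> space (count_space I)"
    then have j: "j \<in> I" by simp
    have "ennreal (2 * osc j) * emeasure W (ball j ((2 / \<delta> + 1) * d j)) \<le>
        ennreal (2 * osc j) * (ennreal D * emeasure W (B j))"
      using doubling[OF j] by (intro mult_left_mono) (auto simp: B_def)
    also have "\<dots> = ennreal (2 * D * osc j) * emeasure W (B j)"
      using osc_nonneg[OF j] D by (simp add: ennreal_mult mult_ac)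
    also have "\<dots> = (\<integral>\<^sup>+z. ennreal (2 * D * osc j) * indicator (B j) z \<partial>W)"
      by (simp add: nn_integral_cmult_indicator)
    also have "\<dots> \<le> (\<integral>\<^sup>+z. ennreal (1 / 2) * (ennreal (u z) * indicator \<Omega> z) * indicator (B j) z +
      ennreal (4 * D * C) * (ennreal (a j powr p) * indicator (B j) z) \<partial>W)"
    proof (intro nn_integral_mono)
      fix z
      show "ennreal (2 * D * osc j) * indicator (B j) z \<le>
        ennreal (1 / 2) * (ennreal (u z) * indicator \<Omega> z) * indicator (B j) z +
        ennreal (4 * D * C) * (ennreal (a j powr p) * indicator (B j) z)"
      proof (cases "z \<in> B j")
        case True
        then have z: "z \<in> \<Omega>" using j_facts(3)[OF j] by blast
        have "2 * D * osc j \<le> 2 * D * (2 * (1 / (8 * D) * u z + C * a j powr p))"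
          using osc_le[OF j True] D by (intro mult_left_mono) auto
        also have "\<dots> = 1 / 2 * u z + 4 * D * C * a j powr p"
          using D by (simp add: field_simps)
        finally have "ennreal (2 * D * osc j) \<le> ennreal (1 / 2 * u z + 4 * D * C * a j powr p)"
          by (rule ennreal_leI)
        also have "\<dots> = ennreal (1 / 2) * ennreal (u z) + ennreal (4 * D * C) * ennreal (a j powr p)"
          using u_bounds(1)[OF z] D C(1)
          by (subst ennreal_plus) (simp_all add: ennreal_mult' del: times_divide_eq_left)
        finally show ?thesis using True z by simp
      qed simp
    qed
    finally show "ennreal (2 * osc j) * emeasure W (ball j ((2 / \<delta> + 1) * d j)) \<le> \<dots>" .
  qed
  also have "\<dots> = (\<integral>\<^sup>+j. (\<integral>\<^sup>+z. ennreal (1 / 2) * (ennreal (u z) * indicator \<Omega> z) * indicator (B j) z \<partial>W) +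
      ennreal (4 * D * C) * (ennreal (a j powr p) * emeasure W (B j)) \<partial>count_space I)"
  proof (rule nn_integral_cong)
    fix j
    have "(\<lambda>z. ennreal (1 / 2) * (ennreal (u z) * indicator \<Omega> z) * indicator (B j) z) \<in> borel_measurable W"
      by (intro borel_measurable_times_ennreal borel_measurable_const u_meas borel_measurable_indicator B_sets)
    moreover have "(\<lambda>z. ennreal (4 * D * C) * (ennreal (a j powr p) * indicator (B j) z)) \<in> borel_measurable W"
      by (intro borel_measurable_times_ennreal borel_measurable_const borel_measurable_indicator B_sets)
    moreover have "(\<integral>\<^sup>+z. ennreal (4 * D * C) * (ennreal (a j powr p) * indicator (B j) z) \<partial>W) =
        ennreal (4 * D * C) * (ennreal (a j powr p) * emeasure W (B j))"
      by (simp add: nn_integral_cmult nn_integral_cmult_indicator)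
    ultimately show "(\<integral>\<^sup>+z. ennreal (1 / 2) * (ennreal (u z) * indicator \<Omega> z) * indicator (B j) z +
      ennreal (4 * D * C) * (ennreal (a j powr p) * indicator (B j) z) \<partial>W) =
      (\<integral>\<^sup>+z. ennreal (1 / 2) * (ennreal (u z) * indicator \<Omega> z) * indicator (B j) z \<partial>W) +
      ennreal (4 * D * C) * (ennreal (a j powr p) * emeasure W (B j))"
      by (simp only: nn_integral_add)
  qed
  also have "\<dots> = (\<integral>\<^sup>+j. (\<integral>\<^sup>+z. ennreal (1 / 2) * (ennreal (u z) * indicator \<Omega> z) * indicator (B j) z \<partial>W) \<partial>count_space I)
      + ennreal (4 * D * C) * S"
    unfolding S_def by (simp add: nn_integral_add nn_integral_cmult)
  also have "(\<integral>\<^sup>+j. (\<integral>\<^sup>+z. ennreal (1 / 2) * (ennreal (u z) * indicator \<Omega> z) * indicator (B j) z \<partial>W) \<partial>count_space I) =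
      (\<integral>\<^sup>+z. (\<integral>\<^sup>+j. ennreal (1 / 2) * (ennreal (u z) * indicator \<Omega> z) * indicator (B j) z \<partial>count_space I) \<partial>W)"
    by (intro nn_integral_count_space_nn_integral[OF countable_I, symmetric]
        borel_measurable_times_ennreal borel_measurable_const u_meas borel_measurable_indicator B_sets)
  also have "\<dots> \<le> (\<integral>\<^sup>+z. ennreal (1 / 2) * (ennreal (u z) * indicator \<Omega> z) \<partial>W)"
  proof (intro nn_integral_mono)
    fix z
    have "(\<integral>\<^sup>+j. indicator (B j) z \<partial>count_space I) \<le> (1 :: ennreal)"
      using nn_integral_count_space_disjoint_indicator[of B I z] disjoint_I by (simp add: B_def indicator_def)
    from mult_left_mono[OF this, of "ennreal (1 / 2) * (ennreal (u z) * indicator \<Omega> z)"]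
    show "(\<integral>\<^sup>+j. ennreal (1 / 2) * (ennreal (u z) * indicator \<Omega> z) * indicator (B j) z \<partial>count_space I)
      \<le> ennreal (1 / 2) * (ennreal (u z) * indicator \<Omega> z)"
      by (subst nn_integral_cmult) auto
  qed
  also have "\<dots> = ennreal (1 / 2) * X"
    unfolding X_def by (rule nn_integral_cmult[OF u_meas])
  finally have ineq: "X \<le> ennreal (1 / 2) * X + ennreal (4 * D * C) * S" by simp
  have "X \<le> ennreal (8 * D * C) * S"
  proof (cases S)
    case top
    then show ?thesis using D C by (simp add: ennreal_mult_top)
  next
    case (real s)
    obtain x where x: "X = ennreal x" "x \<ge> 0" using X_fin by (cases X) auto
    have "ennreal x \<le> ennreal (1 / 2 * x + 4 * D * C * s)"
      using ineq real x D C
      by (subst ennreal_plus) (simp_all add: ennreal_mult' del: times_divide_eq_left)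
    then have "x \<le> 1 / 2 * x + 4 * D * C * s"
      using real x D C by (subst (asm) ennreal_le_iff) auto
    then have "x \<le> 8 * D * C * s" by simp
    then show ?thesis using real x D C by (simp add: ennreal_leI flip: ennreal_mult)
  qed
  then show ?thesis by (simp add: X_def S_def u_def B_def)
qed

lemma sum_of_local_integrals_le:
  fixes W :: "(complex ^ 'n) measure"
  assumes W: "sets W = sets lebesgue" and f: "continuous_on \<Omega> f"
  shows "(\<integral>\<^sup>+j. (\<integral>\<^sup>+z\<in>cball j (d j / 2). ennreal (f z) \<partial>W) \<partial>count_space I) \<le>
    ennreal (120 ^ DIM(complex ^ 'n)) * (\<integral>\<^sup>+z\<in>\<Omega>. ennreal (f z) \<partial>W)"
proof -
  define F where "F = (\<lambda>z. ennreal (f z) * indicator \<Omega> z)"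
  have F: "F \<in> borel_measurable W"
    unfolding F_def using borel_measurable_continuous_indicator_ennreal[OF f] open_\<Omega>
    by (simp cong: measurable_cong_sets add: W)
  have "(\<integral>\<^sup>+j. (\<integral>\<^sup>+z\<in>cball j (d j / 2). ennreal (f z) \<partial>W) \<partial>count_space I) =
      (\<integral>\<^sup>+j. (\<integral>\<^sup>+z. F z * indicator (cball j (d j / 2)) z \<partial>W) \<partial>count_space I)"
  proof (intro nn_integral_cong)
    fix j z assume "j \<in> space (count_space I)"
    then have j: "j \<in> \<Omega>" using I_subset by auto
    have "cball j (d j / 2) \<subseteq> ball j (d j)" using d_pos[OF j] by auto
    then have "cball j (d j / 2) \<subseteq> \<Omega>" using ball_d_subset[OF j, of "d j"] by auto
    then show "ennreal (f z) * indicator (cball j (d j / 2)) z = F z * indicator (cball j (d j / 2)) z"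
      by (auto simp: F_def indicator_def)
  qed
  also have "\<dots> = (\<integral>\<^sup>+z. (\<integral>\<^sup>+j. F z * indicator (cball j (d j / 2)) z \<partial>count_space I) \<partial>W)"
    by (intro nn_integral_count_space_nn_integral[OF countable_I, symmetric]
        borel_measurable_times_ennreal F borel_measurable_indicator) (simp add: W)
  also have "\<dots> \<le> (\<integral>\<^sup>+z. ennreal (120 ^ DIM(complex ^ 'n)) * F z \<partial>W)"
  proof (intro nn_integral_mono)
    fix z
    show "(\<integral>\<^sup>+j. F z * indicator (cball j (d j / 2)) z \<partial>count_space I) \<le> ennreal (120 ^ DIM(complex ^ 'n)) * F z"
    proof (cases "z \<in> \<Omega>")
      case True
      have "(\<integral>\<^sup>+j. F z * indicator (cball j (d j / 2)) z \<partial>count_space I) =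
          F z * (\<integral>\<^sup>+j. indicator (cball j (d j / 2)) z \<partial>count_space I)"
        by (rule nn_integral_cmult) simp
      also have "\<dots> \<le> F z * ennreal (120 ^ DIM(complex ^ 'n))"
        by (intro mult_left_mono whitney_overlap True) simp
      finally show ?thesis by (simp add: mult.commute)
    qed (simp add: F_def)
  qed
  also have "\<dots> = ennreal (120 ^ DIM(complex ^ 'n)) * (\<integral>\<^sup>+z. F z \<partial>W)"
    by (rule nn_integral_cmult[OF F])
  finally show ?thesis by (simp add: F_def)
qed

end

section \<open>Holomorphic parts on John domains\<close>

text \<open>
  The Poincare inequality is applied to the truncations of \<open>\<bar>h - h(x\<^sub>0)\<bar>\<close>, with the oscillations from
  the local estimate. The constant depends neither on the level of truncation nor on the domain, the
  functions and the weight.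
\<close>

lemma john_domain_holomorphic_part_bound:
  fixes p q M \<delta> :: real
  assumes p: "p > 0" and q: "q > 1" and M: "M \<ge> 1" and \<delta>: "\<delta> > 0"
  obtains K where "K > 0"
    "\<And>(\<Omega> :: (complex ^ 'n) set) h g \<omega>. john_domain \<delta> \<Omega> \<Longrightarrow>
      holomorphic_on_cn h \<Omega> \<Longrightarrow> holomorphic_on_cn g \<Omega> \<Longrightarrow> muckenhoupt q M \<omega> \<Longrightarrow>
      \<exists>a. (\<integral>\<^sup>+z\<in>\<Omega>. ennreal (norm (h z - a) powr p) \<partial>weighted_lebesgue \<omega>) \<le>
        ennreal K * (\<integral>\<^sup>+z\<in>\<Omega>. ennreal (norm (h z + cnj (g z)) powr p) \<partial>weighted_lebesgue \<omega>)"
proof -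
  define N where "N = DIM(complex ^ 'n)"
  define C1 where "C1 = 2 / \<delta> + 1"
  have C1: "C1 \<ge> 1" using \<delta> by (simp add: C1_def)
  obtain K0 where K0: "K0 > 0" and local_bound:
    "\<And>\<omega> h g (x :: complex ^ 'n) d. muckenhoupt q M \<omega> \<Longrightarrow>
      holomorphic_on_cn h (ball x d) \<Longrightarrow> holomorphic_on_cn g (ball x d) \<Longrightarrow> d > 0 \<Longrightarrow>
      \<exists>a\<ge>0. (\<forall>y\<in>ball x (d / 8). norm (h y - h x) \<le> a) \<and>
        ennreal (a powr p) * emeasure (weighted_lebesgue \<omega>) (ball x (C1 * d)) \<le>
          ennreal K0 * (\<integral>\<^sup>+z\<in>cball x (d / 2). ennreal (norm (h z + cnj (g z)) powr p) \<partial>weighted_lebesgue \<omega>)"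
    using weighted_oscillation_bound[OF p q M C1, where 'n='n] by blast
  define D where "D = 2 powr q * M * ((40 * C1) ^ N) powr q"
  have D: "D > 0" using M C1 by (simp add: D_def)
  obtain C where C: "C > 0" "\<And>s t. 0 \<le> s \<Longrightarrow> 0 \<le> t \<Longrightarrow>
      \<bar>s powr p - t powr p\<bar> \<le> 1 / (8 * D) * t powr p + C * \<bar>s - t\<bar> powr p"
    using powr_diff_le[OF p, of "1 / (8 * D)"] D by auto
  define K where "K = 8 * D * C * 2 powr p * K0 * 120 ^ N"
  have K: "K > 0" using D C K0 by (simp add: K_def)
  show ?thesis
  proof (rule that[OF K])
    fix \<Omega> :: "(complex ^ 'n) set" and h g :: "complex ^ 'n \<Rightarrow> complex" and \<omega> :: "complex ^ 'n \<Rightarrow> real"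
    assume john: "john_domain \<delta> \<Omega>" and h: "holomorphic_on_cn h \<Omega>" and g: "holomorphic_on_cn g \<Omega>"
      and A: "muckenhoupt q M \<omega>"
    define W where "W = weighted_lebesgue \<omega>"
    have \<omega>: "weight \<omega>" using A by (simp add: muckenhoupt_def)
    have W_sets: "sets W = sets lebesgue" by (simp add: W_def)
    define d where "d = (\<lambda>x. infdist x (frontier \<Omega>))"
    obtain x0 I where "whitney_john \<delta> \<Omega> d x0 I"
      using john_domain_whitney[OF john \<delta>] unfolding d_def by blast
    then interpret whitney_john \<delta> \<Omega> d x0 I .
    have h_cont: "continuous_on \<Omega> h" and g_cont: "continuous_on \<Omega> g"
      using h g by (auto intro: holomorphic_on_cn_imp_continuous_on)
    define f where "f = (\<lambda>z. norm (h z + cnj (g z)) powr p)"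
    have f_cont: "continuous_on \<Omega> f"
      unfolding f_def using p by (intro continuous_on_powr' continuous_intros h_cont g_cont) auto
    have "\<forall>j\<in>I. \<exists>a\<ge>0. (\<forall>y\<in>ball j (d j / 8). norm (h y - h j) \<le> a) \<and>
        ennreal (a powr p) * emeasure W (ball j (C1 * d j)) \<le>
          ennreal K0 * (\<integral>\<^sup>+z\<in>cball j (d j / 2). ennreal (f z) \<partial>W)"
    proof
      fix j assume "j \<in> I"
      then have j: "j \<in> \<Omega>" using I_subset by blast
      have "ball j (d j) \<subseteq> \<Omega>" using ball_d_subset[OF j] by simp
      then show "\<exists>a\<ge>0. (\<forall>y\<in>ball j (d j / 8). norm (h y - h j) \<le> a) \<and>
        ennreal (a powr p) * emeasure W (ball j (C1 * d j)) \<le>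
          ennreal K0 * (\<integral>\<^sup>+z\<in>cball j (d j / 2). ennreal (f z) \<partial>W)"
        unfolding W_def f_def
        by (intro local_bound A d_pos[OF j] holomorphic_on_cn_subset[OF h] holomorphic_on_cn_subset[OF g])
    qed
    from bchoice[OF this] obtain a where a: "\<forall>j\<in>I. 0 \<le> a j \<and>
        (\<forall>y\<in>ball j (d j / 8). norm (h y - h j) \<le> a j) \<and>
        ennreal (a j powr p) * emeasure W (ball j (C1 * d j)) \<le>
          ennreal K0 * (\<integral>\<^sup>+z\<in>cball j (d j / 2). ennreal (f z) \<partial>W)" ..
    have a_nonneg: "a j \<ge> 0"
      and a_osc: "\<And>y. y \<in> ball j (d j / 8) \<Longrightarrow> norm (h y - h j) \<le> a j"
      and a_bound: "ennreal (a j powr p) * emeasure W (ball j (C1 * d j)) \<le>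
          ennreal K0 * (\<integral>\<^sup>+z\<in>cball j (d j / 2). ennreal (f z) \<partial>W)" if "j \<in> I" for j
      using bspec[OF a that] by (simp_all del: mem_ball)
    have W_fin: "emeasure W \<Omega> < \<infinity>"
    proof -
      have "\<Omega> \<subseteq> ball x0 (d x0 / \<delta> + 1)" using domain_subset_ball by force
      then have "emeasure W \<Omega> \<le> emeasure W (ball x0 (d x0 / \<delta> + 1))"
        by (intro emeasure_mono) (auto simp: W_sets)
      also have "\<dots> < \<infinity>" unfolding W_def by (rule emeasure_weighted_ball_finite[OF \<omega>])
      finally show ?thesis .
    qed
    have doubling: "emeasure W (ball j ((2 / \<delta> + 1) * d j)) \<le> ennreal D * emeasure W (ball j (d j / 40))"
      if "j \<in> I" for j
    proof -
      have dj: "d j > 0" using that I_subset d_pos by blast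
      have le: "d j / 40 \<le> C1 * d j" using dj C1 mult_right_mono[of 1 C1 "d j"] by simp
      have "emeasure W (ball j (C1 * d j)) \<le>
          ennreal (2 powr q * M * ((C1 * d j / (d j / 40)) ^ N) powr q) * emeasure W (ball j (d j / 40))"
        unfolding W_def N_def
        by (rule muckenhoupt_doubling[OF A q M _ subset_ball[OF le]]) (use dj in simp)
      moreover have "C1 * d j / (d j / 40) = 40 * C1" using dj by simp
      ultimately show ?thesis by (simp only: D_def C1_def)
    qed
    define G where "G = (\<lambda>n::nat. \<lambda>z. min (norm (h z - h x0)) (real n))"
    define R where "R = ennreal K * (\<integral>\<^sup>+z\<in>\<Omega>. ennreal (f z) \<partial>W)"
    have truncated: "(\<integral>\<^sup>+z\<in>\<Omega>. ennreal (G n z powr p) \<partial>W) \<le> R" for n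
    proof -
      have "(\<integral>\<^sup>+z\<in>\<Omega>. ennreal (G n z powr p) \<partial>W) \<le>
        ennreal (8 * D * C) * (\<integral>\<^sup>+j. ennreal ((2 * a j) powr p) * emeasure W (ball j (d j / 40)) \<partial>count_space I)"
      proof (rule john_poincare[OF W_sets W_fin p _ _ _ _ D doubling C, where T = "real n"])
        show "continuous_on \<Omega> (G n)" unfolding G_def by (intro continuous_intros h_cont)
        show "\<bar>G n y - G n z\<bar> \<le> 2 * a j"
          if "j \<in> I" "y \<in> ball j (d j / 8)" "z \<in> ball j (d j / 8)" for j y z
        proof -
          have "\<bar>G n y - G n z\<bar> \<le> \<bar>norm (h y - h x0) - norm (h z - h x0)\<bar>"
            unfolding G_def by linarith
          also have "\<dots> \<le> norm (h y - h z)"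
            using norm_triangle_ineq3[of "h y - h x0" "h z - h x0"] by simp
          also have "\<dots> \<le> norm (h y - h j) + norm (h z - h j)"
            using norm_triangle_ineq4[of "h y - h j" "h z - h j"] by simp
          also have "\<dots> \<le> 2 * a j" using a_osc[OF that(1,2)] a_osc[OF that(1,3)] by simp
          finally show ?thesis .
        qed
      qed (auto simp: G_def)
      also have "\<dots> \<le> ennreal (8 * D * C) * (\<integral>\<^sup>+j. ennreal (2 powr p * K0) *
          (\<integral>\<^sup>+z\<in>cball j (d j / 2). ennreal (f z) \<partial>W) \<partial>count_space I)"
      proof (intro mult_left_mono nn_integral_mono)
        fix j assume "j \<in> space (count_space I)"
        then have j: "j \<in> I" by simp
        have dj: "d j > 0" using j I_subset d_pos by blast
        have "d j / 40 \<le> C1 * d j" using dj C1 mult_right_mono[of 1 C1 "d j"] by simp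
        then have "emeasure W (ball j (d j / 40)) \<le> emeasure W (ball j (C1 * d j))"
          by (intro emeasure_mono subset_ball) (simp_all add: W_sets)
        then have "ennreal ((2 * a j) powr p) * emeasure W (ball j (d j / 40)) \<le>
            ennreal (2 powr p) * (ennreal (a j powr p) * emeasure W (ball j (C1 * d j)))"
          using a_nonneg[OF j] by (simp add: powr_mult ennreal_mult mult.assoc mult_left_mono)
        also have "\<dots> \<le> ennreal (2 powr p) * (ennreal K0 * (\<integral>\<^sup>+z\<in>cball j (d j / 2). ennreal (f z) \<partial>W))"
          by (intro mult_left_mono a_bound j) simp
        finally show "ennreal ((2 * a j) powr p) * emeasure W (ball j (d j / 40)) \<le>
            ennreal (2 powr p * K0) * (\<integral>\<^sup>+z\<in>cball j (d j / 2). ennreal (f z) \<partial>W)"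
          using K0 by (simp add: ennreal_mult mult.assoc)
      qed simp
      also have "\<dots> = ennreal (8 * D * C) * (ennreal (2 powr p * K0) *
          (\<integral>\<^sup>+j. (\<integral>\<^sup>+z\<in>cball j (d j / 2). ennreal (f z) \<partial>W) \<partial>count_space I))"
        by (subst nn_integral_cmult) auto
      also have "\<dots> \<le> ennreal (8 * D * C) * (ennreal (2 powr p * K0) *
          (ennreal (120 ^ N) * (\<integral>\<^sup>+z\<in>\<Omega>. ennreal (f z) \<partial>W)))"
        unfolding N_def by (intro mult_left_mono sum_of_local_integrals_le[OF W_sets f_cont]) auto
      also have "\<dots> = R"
        unfolding R_def K_def using D C K0 by (simp add: ennreal_mult mult.assoc)
      finally show ?thesis .
    qed
    \<comment> \<open>Removing the truncation by monotone convergence.\<close>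
    have "(\<integral>\<^sup>+z\<in>\<Omega>. ennreal (norm (h z - h x0) powr p) \<partial>W) =
        (\<integral>\<^sup>+z. (SUP n. ennreal (G n z powr p) * indicator \<Omega> z) \<partial>W)"
    proof (intro nn_integral_cong)
      fix z
      obtain n where "norm (h z - h x0) \<le> real n" using real_arch_simple by blast
      then have "G n z = norm (h z - h x0)" by (simp add: G_def)
      then have "ennreal (norm (h z - h x0) powr p) * indicator \<Omega> z \<le> (SUP n. ennreal (G n z powr p) * indicator \<Omega> z)"
        by (intro SUP_upper2[of n]) auto
      moreover have "(SUP n. ennreal (G n z powr p) * indicator \<Omega> z) \<le> ennreal (norm (h z - h x0) powr p) * indicator \<Omega> z"
        using p by (intro SUP_least mult_right_mono ennreal_leI powr_mono2) (auto simp: G_def)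
      ultimately show "ennreal (norm (h z - h x0) powr p) * indicator \<Omega> z = (SUP n. ennreal (G n z powr p) * indicator \<Omega> z)"
        by (rule antisym)
    qed
    also have "\<dots> = (SUP n. (\<integral>\<^sup>+z\<in>\<Omega>. ennreal (G n z powr p) \<partial>W))"
    proof (rule nn_integral_monotone_convergence_SUP)
      show "incseq (\<lambda>n z. ennreal (G n z powr p) * indicator \<Omega> z)"
        using p by (intro incseq_SucI le_funI mult_right_mono ennreal_leI powr_mono2) (auto simp: G_def)
      show "(\<lambda>z. ennreal (G n z powr p) * indicator \<Omega> z) \<in> borel_measurable W" for n
      proof -
        have "continuous_on \<Omega> (\<lambda>z. G n z powr p)"
          unfolding G_def using p by (intro continuous_on_powr' continuous_intros h_cont) auto
        then show ?thesis
          using borel_measurable_continuous_indicator_ennreal[of \<Omega> "\<lambda>z. G n z powr p"] open_\<Omega>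
          by (simp cong: measurable_cong_sets add: W_sets)
      qed
    qed
    also have "\<dots> \<le> R" by (intro SUP_least truncated)
    finally show "\<exists>a. (\<integral>\<^sup>+z\<in>\<Omega>. ennreal (norm (h z - a) powr p) \<partial>weighted_lebesgue \<omega>) \<le>
        ennreal K * (\<integral>\<^sup>+z\<in>\<Omega>. ennreal (norm (h z + cnj (g z)) powr p) \<partial>weighted_lebesgue \<omega>)"
      unfolding R_def W_def f_def by blast
  qed
qed

lemma ennreal_rpow_scaled_mono:
  assumes le: "X \<le> ennreal K * Y" and K: "K > 0" and s: "s > 0"
  shows "ennreal_rpow X s \<le> ennreal (K powr s) * ennreal_rpow Y s"
proof (cases Y)
  case top
  then show ?thesis using K s by (simp add: ennreal_rpow_def ennreal_mult_top)
next
  case (real y)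
  then have "X \<le> ennreal (K * y)" using le K by (simp add: ennreal_mult)
  then obtain x where x: "X = ennreal x" "0 \<le> x" "x \<le> K * y"
    using real K by (cases X) (auto simp: top_unique ennreal_le_iff)
  have rpow: "ennreal_rpow (ennreal t) s = ennreal (t powr s)" if "t \<ge> 0" for t
    using that s by (auto simp: ennreal_rpow_def)
  have "x powr s \<le> (K * y) powr s" using x s by (intro powr_mono2) auto
  then have "ennreal (x powr s) \<le> ennreal (K powr s * y powr s)"
    using K real by (simp add: powr_mult ennreal_leI)
  then show ?thesis using x real K by (simp add: rpow ennreal_mult)
qed

lemma wnorm_weighted_lebesgue:
  assumes \<omega>: "weight \<omega>" and E: "open E" and F: "continuous_on E F" and p: "p > 0"
  shows "wnorm p E \<omega> F =
    ennreal_rpow (\<integral>\<^sup>+x\<in>E. ennreal (norm (F x) powr p) \<partial>weighted_lebesgue \<omega>) (1 / p)"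
proof -
  have "continuous_on E (\<lambda>x. norm (F x) powr p)"
    using p by (intro continuous_on_powr' continuous_intros F) auto
  then have "(\<integral>\<^sup>+x\<in>E. ennreal (norm (F x) powr p) \<partial>weighted_lebesgue \<omega>) =
      (\<integral>\<^sup>+x. ennreal (\<omega> x) * (ennreal (norm (F x) powr p) * indicator E x) \<partial>lebesgue)"
    using E by (intro nn_integral_weighted_lebesgue[OF \<omega>] borel_measurable_continuous_indicator_ennreal) auto
  also have "\<dots> = (\<integral>\<^sup>+x\<in>E. ennreal (norm (F x) powr p * \<omega> x) \<partial>lebesgue)"
    by (intro nn_integral_cong) (simp add: ennreal_mult'' mult_ac)
  finally show ?thesis by (simp add: wnorm_def)
qed

theorem theorem2p6:
  fixes p q M \<delta> :: real
  assumes "p > 0" and "q > 1" and "M \<ge> 1" and "\<delta> > 0"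
  shows "\<exists>C::real. C > 0 \<and>
    (\<forall>(\<Omega> :: (complex ^ 'n) set) f h g \<omega>.
      john_domain \<delta> \<Omega> \<longrightarrow>
      pluriharmonic_on f \<Omega> \<longrightarrow>
      holomorphic_on_cn h \<Omega> \<longrightarrow>
      holomorphic_on_cn g \<Omega> \<longrightarrow>
      (\<forall>z\<in>\<Omega>. f z = h z + cnj (g z)) \<longrightarrow>
      muckenhoupt q M \<omega> \<longrightarrow>
      (INF a. wnorm p \<Omega> \<omega> (\<lambda>z. h z - a)) + (INF b. wnorm p \<Omega> \<omega> (\<lambda>z. g z - b))
        \<le> ennreal C * wnorm p \<Omega> \<omega> f)"
proof -
  obtain K where K: "K > 0" and bound:
    "\<And>(\<Omega> :: (complex ^ 'n) set) h g \<omega>. john_domain \<delta> \<Omega> \<Longrightarrow>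
      holomorphic_on_cn h \<Omega> \<Longrightarrow> holomorphic_on_cn g \<Omega> \<Longrightarrow> muckenhoupt q M \<omega> \<Longrightarrow>
      \<exists>a. (\<integral>\<^sup>+z\<in>\<Omega>. ennreal (norm (h z - a) powr p) \<partial>weighted_lebesgue \<omega>) \<le>
        ennreal K * (\<integral>\<^sup>+z\<in>\<Omega>. ennreal (norm (h z + cnj (g z)) powr p) \<partial>weighted_lebesgue \<omega>)"
    using john_domain_holomorphic_part_bound[OF assms, where 'n='n] by blast
  define C where "C = 2 * K powr (1 / p)"
  have C_pos: "C > 0" using K by (simp add: C_def)
  have main: "(INF a. wnorm p \<Omega> \<omega> (\<lambda>z. h z - a)) + (INF b. wnorm p \<Omega> \<omega> (\<lambda>z. g z - b))
        \<le> ennreal C * wnorm p \<Omega> \<omega> f"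
    if john: "john_domain \<delta> \<Omega>" and h: "holomorphic_on_cn h \<Omega>" and g: "holomorphic_on_cn g \<Omega>"
      and f: "\<forall>z\<in>\<Omega>. f z = h z + cnj (g z)" and A: "muckenhoupt q M \<omega>"
    for \<Omega> :: "(complex ^ 'n) set" and f h g \<omega>
  proof -
    have op: "open \<Omega>" using john by (simp add: john_domain_def)
    have \<omega>: "weight \<omega>" using A by (simp add: muckenhoupt_def)
    have one_part: "(INF a. wnorm p \<Omega> \<omega> (\<lambda>z. \<phi> z - a)) \<le> ennreal (K powr (1 / p)) * wnorm p \<Omega> \<omega> f"
      if \<phi>: "holomorphic_on_cn \<phi> \<Omega>" and \<psi>: "holomorphic_on_cn \<psi> \<Omega>"
        and norm_f: "\<And>z. z \<in> \<Omega> \<Longrightarrow> norm (\<phi> z + cnj (\<psi> z)) = norm (f z)" for \<phi> \<psi>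
    proof -
      have \<phi>_cont: "continuous_on \<Omega> \<phi>" and \<psi>_cont: "continuous_on \<Omega> \<psi>"
        using \<phi> \<psi> by (auto intro: holomorphic_on_cn_imp_continuous_on)
      obtain a where a: "(\<integral>\<^sup>+z\<in>\<Omega>. ennreal (norm (\<phi> z - a) powr p) \<partial>weighted_lebesgue \<omega>) \<le>
        ennreal K * (\<integral>\<^sup>+z\<in>\<Omega>. ennreal (norm (\<phi> z + cnj (\<psi> z)) powr p) \<partial>weighted_lebesgue \<omega>)"
        using bound[OF john \<phi> \<psi> A] by blast
      have "(INF a. wnorm p \<Omega> \<omega> (\<lambda>z. \<phi> z - a)) \<le> wnorm p \<Omega> \<omega> (\<lambda>z. \<phi> z - a)"
        by (rule INF_lower) simp
      also have "\<dots> = ennreal_rpow (\<integral>\<^sup>+z\<in>\<Omega>. ennreal (norm (\<phi> z - a) powr p) \<partial>weighted_lebesgue \<omega>) (1 / p)"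
        using assms by (intro wnorm_weighted_lebesgue \<omega> op continuous_intros \<phi>_cont) auto
      also have "\<dots> \<le> ennreal (K powr (1 / p)) *
          ennreal_rpow (\<integral>\<^sup>+z\<in>\<Omega>. ennreal (norm (\<phi> z + cnj (\<psi> z)) powr p) \<partial>weighted_lebesgue \<omega>) (1 / p)"
        using assms by (intro ennreal_rpow_scaled_mono a K) auto
      also have "ennreal_rpow (\<integral>\<^sup>+z\<in>\<Omega>. ennreal (norm (\<phi> z + cnj (\<psi> z)) powr p) \<partial>weighted_lebesgue \<omega>) (1 / p) =
          wnorm p \<Omega> \<omega> (\<lambda>z. \<phi> z + cnj (\<psi> z))"
        using assms by (intro wnorm_weighted_lebesgue[symmetric] \<omega> op continuous_intros \<phi>_cont \<psi>_cont) auto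
      also have "wnorm p \<Omega> \<omega> (\<lambda>z. \<phi> z + cnj (\<psi> z)) = wnorm p \<Omega> \<omega> f"
        unfolding wnorm_def
        by (intro arg_cong2[where f = ennreal_rpow] nn_integral_cong refl)
           (auto simp: indicator_def norm_f)
      finally show ?thesis .
    qed
    have norm_swap: "norm (g z + cnj (h z)) = norm (f z)" if "z \<in> \<Omega>" for z
    proof -
      have "g z + cnj (h z) = cnj (f z)" using f that by simp
      then show ?thesis by simp
    qed
    have "(INF a. wnorm p \<Omega> \<omega> (\<lambda>z. h z - a)) + (INF b. wnorm p \<Omega> \<omega> (\<lambda>z. g z - b))
        \<le> ennreal (K powr (1 / p)) * wnorm p \<Omega> \<omega> f + ennreal (K powr (1 / p)) * wnorm p \<Omega> \<omega> f"
      using f norm_swap by (intro add_mono one_part[OF h g] one_part[OF g h]) auto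
    also have "\<dots> = ennreal C * wnorm p \<Omega> \<omega> f"
    proof -
      have "ennreal C = ennreal (K powr (1 / p)) + ennreal (K powr (1 / p))"
        unfolding C_def mult_2 by (rule ennreal_plus) simp_all
      then show ?thesis by (simp only: distrib_right)
    qed
    finally show ?thesis .
  qed
  show ?thesis by (intro exI[of _ C] conjI allI impI C_pos main)
qed

end
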